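(* Let $(p_i)_{i\in\mathbb Z}$ be i.i.d. random variables with values in $(0,1)$, and let $q_i=1-p_i$. Given $(p_i)$, consider the system of independent particles on $\mathbb Z$, each of which evolves as a continuous time Markov chain with unit exponential holding times and transition probabilities $p_i$ from $i$ to $i+1$ and $q_i$ from $i$ to $i-1$. Then, with probability 1 with respect to the choice of $(p_i)$, there is an extremal stationary distribution for the independent particle system with positive flux if $E\log(p_0/q_0)>0$, and one with negative flux if $E\log(q_0/p_0)>0$.
   Context: The expectation $E\log(p_0/q_0)$ is assumed to exist in the stated conditions. For fixed $(p_i)$, configurations of the independent particle system are $\eta\in\{0,1,2,\dots\}^{\mathbb Z}$, where $\eta(i)$ is the number of particles at $i$. A probability measure $\mu$ on configurations is a stationary distribution if, when the initial configuration has law $\mu$ and all particles then move independently according to the one-particle chain, the configuration at each time $t\ge0$ again has law $\mu$. It is extremal if it is an extreme point of the convex set of stationary distributions. The flux of particles between $i$ and $i+1$ in a stationary distribution with finite means $\sigma_i=E\eta(i)$ is $$\phi=p_i\sigma_i-q_{i+1}\sigma_{i+1},$$ which does not depend on $i$ because stationarity gives $\sigma_i=\sigma_{i-1}p_{i-1}+\sigma_{i+1}q_{i+1}$ for all $i\in\mathbb Z$. *)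

theory Defs
  imports "HOL-Probability.Probability"
begin

section \<open>The one-particle chain in a fixed environment\<close>

text \<open>
  An environment is a function \<open>p :: int \<Rightarrow> real\<close>; a particle at \<open>i\<close> jumps to \<open>i + 1\<close> with
  probability \<open>p i\<close> and to \<open>i - 1\<close> with probability \<open>1 - p i\<close>.  The randomness driving one
  particle is a sequence \<open>w\<close> of independent pairs: \<open>fst (w n)\<close> is the exponential holding time
  before jump number \<open>n\<close> (counting from 0), and the independent uniform variable \<open>snd (w n)\<close>
  decides the direction of that jump.
\<close>

definition noise_space :: "(nat \<Rightarrow> real \<times> real) measure" where
  "noise_space = (\<Pi>\<^sub>M n\<in>UNIV.
     density lborel (exponential_density 1) \<Otimes>\<^sub>M uniform_measure lborel {0..1})"

primrec jump_chain :: "(int \<Rightarrow> real) \<Rightarrow> int \<Rightarrow> (nat \<Rightarrow> real \<times> real) \<Rightarrow> nat \<Rightarrow> int" where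
  "jump_chain p i w 0 = i"
| "jump_chain p i w (Suc n) =
     (if snd (w n) < p (jump_chain p i w n) then jump_chain p i w n + 1
      else jump_chain p i w n - 1)"

text \<open>
  The number of jumps up to time \<open>t\<close>.  The set is almost surely finite; on the null
  set where it is infinite, the value of \<open>card\<close> is irrelevant.
\<close>

definition jump_count :: "(nat \<Rightarrow> real \<times> real) \<Rightarrow> real \<Rightarrow> nat" where
  "jump_count w t = card {n. (\<Sum>k\<le>n. fst (w k)) \<le> t}"

definition position :: "(int \<Rightarrow> real) \<Rightarrow> int \<Rightarrow> (nat \<Rightarrow> real \<times> real) \<Rightarrow> real \<Rightarrow> int" where
  "position p i w t = jump_chain p i w (jump_count w t)"


section \<open>The system of independent particles\<close>

abbreviation config_space :: "(int \<Rightarrow> nat) measure" where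
  "config_space \<equiv> \<Pi>\<^sub>M i\<in>UNIV. count_space UNIV"

text \<open>
  The particles of an initial configuration \<open>\<eta>\<close> are labelled by the pairs \<open>(i, k)\<close> with
  \<open>k < \<eta> i\<close>: the particle \<open>(i, k)\<close> starts at \<open>i\<close> and is driven by its own noise \<open>W (i, k)\<close>.
\<close>

definition particles_at ::
  "(int \<Rightarrow> real) \<Rightarrow> real \<Rightarrow> (int \<Rightarrow> nat) \<Rightarrow> (int \<times> nat \<Rightarrow> nat \<Rightarrow> real \<times> real) \<Rightarrow> int \<Rightarrow> (int \<times> nat) set"
where
  "particles_at p t \<eta> W j = {(i, k). k < \<eta> i \<and> position p i (W (i, k)) t = j}"

text \<open>Initial configuration with law \<open>\<mu>\<close>, independent of the i.i.d. driving noises.\<close>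

definition system_space ::
  "(int \<Rightarrow> nat) measure \<Rightarrow> ((int \<Rightarrow> nat) \<times> (int \<times> nat \<Rightarrow> nat \<Rightarrow> real \<times> real)) measure"
where
  "system_space \<mu> = \<mu> \<Otimes>\<^sub>M (\<Pi>\<^sub>M a\<in>UNIV. noise_space)"

text \<open>
  Infinitely many particles could meet at one site at time \<open>t\<close>, in which case \<open>card\<close> would
  be 0; hence the separate requirement that this almost surely does not happen.
\<close>

definition stationary :: "(int \<Rightarrow> real) \<Rightarrow> (int \<Rightarrow> nat) measure \<Rightarrow> bool" where
  "stationary p \<mu> \<longleftrightarrow> prob_space \<mu> \<and> sets \<mu> = sets config_space \<and>
     (\<forall>t\<ge>0. (AE (\<eta>, W) in system_space \<mu>. \<forall>j. finite (particles_at p t \<eta> W j)) \<and>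
            distr (system_space \<mu>) config_space (\<lambda>(\<eta>, W) j. card (particles_at p t \<eta> W j)) = \<mu>)"

text \<open>
  Extreme points of the convex set of stationary distributions.  Measures do not form a
  real vector space, so convex combinations are written out setwise.
\<close>

definition extremal_stationary :: "(int \<Rightarrow> real) \<Rightarrow> (int \<Rightarrow> nat) measure \<Rightarrow> bool" where
  "extremal_stationary p \<mu> \<longleftrightarrow> stationary p \<mu> \<and>
     (\<forall>\<mu>1 \<mu>2 c. stationary p \<mu>1 \<longrightarrow> stationary p \<mu>2 \<longrightarrow> 0 < c \<longrightarrow> c < 1 \<longrightarrow>
        (\<forall>A\<in>sets config_space. measure \<mu> A = c * measure \<mu>1 A + (1 - c) * measure \<mu>2 A) \<longrightarrow>
        \<mu>1 = \<mu> \<and> \<mu>2 = \<mu>)"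

definition site_mean :: "(int \<Rightarrow> nat) measure \<Rightarrow> int \<Rightarrow> real" where
  "site_mean \<mu> i = (\<integral>\<eta>. real (\<eta> i) \<partial>\<mu>)"

definition has_flux :: "(int \<Rightarrow> real) \<Rightarrow> (int \<Rightarrow> nat) measure \<Rightarrow> real \<Rightarrow> bool" where
  "has_flux p \<mu> \<phi> \<longleftrightarrow> (\<forall>i. integrable \<mu> (\<lambda>\<eta>. real (\<eta> i))) \<and>
     (\<forall>i. \<phi> = p i * site_mean \<mu> i - (1 - p (i + 1)) * site_mean \<mu> (i + 1))"


section \<open>Expectations in the extended sense\<close>

text \<open>
  The expectation exists if the positive or the negative part is integrable; its value may
  then be infinite.
\<close>

definition expectation_exists :: "'a measure \<Rightarrow> ('a \<Rightarrow> real) \<Rightarrow> bool" where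
  "expectation_exists M f \<longleftrightarrow> f \<in> borel_measurable M \<and>
     ((\<integral>\<^sup>+x. ennreal (f x) \<partial>M) < \<infinity> \<or> (\<integral>\<^sup>+x. ennreal (- f x) \<partial>M) < \<infinity>)"

definition ext_expectation :: "'a measure \<Rightarrow> ('a \<Rightarrow> real) \<Rightarrow> ereal" where
  "ext_expectation M f =
     enn2ereal (\<integral>\<^sup>+x. ennreal (f x) \<partial>M) - enn2ereal (\<integral>\<^sup>+x. ennreal (- f x) \<partial>M)"

end

theory Submission
  imports Defs
begin

text \<open>
  Write \<open>q = 1 - p\<close> and \<open>\<rho> = q / p\<close>.  When the drift \<open>E log (p 0 / q 0)\<close> is positive, the
  products \<open>\<rho> (i + 1) \<cdots> \<rho> (i + n)\<close> are almost surely summable in \<open>n\<close>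
  (\<open>AE_summable_prod_odds\<close>), because a random walk with positive drift is bounded below
  (\<open>walk_min_bounded_AE\<close>).  The series then serves twice.  Divided by \<open>p i\<close> it gives
  intensities \<open>\<sigma> i\<close> with constant flux 1, so that \<open>\<sigma>\<close> is an invariant measure of the
  one-particle chain; its tails give a bounded superharmonic function which forces the chain to be
  transient (\<open>step_prob_tendsto_0\<close>).  The stationary distribution is the law \<open>poisson_field \<sigma>\<close>
  under which the \<open>\<eta> i\<close> are independent Poisson variables with means \<open>\<sigma> i\<close>.

  Laws of configurations are compared through their generating functionals, the expectations of
  \<open>\<Prod>j\<in>J. s j ^ \<eta> j\<close> with \<open>0 \<le> s \<le> 1\<close> and \<open>J\<close> finite (\<open>config_measure_eqI\<close>).
  Put \<open>s = 1\<close> off \<open>J\<close> and let \<open>v i\<close> be the expectation of \<open>s\<close> at the time-\<open>t\<close> position of a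
  particle started at \<open>i\<close>.  As particles move independently, the functional at time \<open>t\<close> has
  conditional expectation \<open>\<Psi>\<^sub>t \<eta> = (\<Prod>i. v i ^ \<eta> i)\<close> given the initial configuration \<open>\<eta>\<close>
  (\<open>generating_functional_system_limit\<close>).  For the Poisson field its mean is
  \<open>exp (- (\<Sum>i. \<sigma> i * (1 - v i)))\<close>, and invariance of \<open>\<sigma>\<close> turns the exponent into
  \<open>\<Sum>j\<in>J. \<sigma> j * (1 - s j)\<close>, the value at time 0: the field is stationary.

  Extremality is a mixing property.  A stationary distribution that occurs in a convex
  decomposition of the Poisson field has a density \<open>h\<close> with respect to it, and by stationarity the
  integral of \<open>h * \<Psi>\<^sub>t\<close> is the value of its own generating functional, for every \<open>t\<close>.  By transience
  \<open>v i\<close> tends to 1 at each fixed site, so initial data in a finite window are forgotten: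
  the integral of \<open>h * \<Psi>\<^sub>t\<close> tends to \<open>exp (- (\<Sum>j\<in>J. \<sigma> j * (1 - s j)))\<close> when \<open>h\<close> is the indicator
  of a cylinder, normalized to a probability density, hence for every density \<open>h\<close>
  (\<open>later_functional_mixing\<close>).  The two laws therefore have the same generating functional.

  For negative drift the same construction is applied to the reflected environment
  \<open>1 - p (- i)\<close>.  Only transience and the intensities are reflected back, not the particle
  system itself.
\<close>

section \<open>Random walks with positive drift\<close>

text \<open>The minimum of the partial sums \<open>z 0 + \<dots> + z (k - 1)\<close> over \<open>k \<le> n\<close>.  The recursion
  splits off the first step instead of the last, so that it commutes with the shift.\<close>

primrec walk_min :: "nat \<Rightarrow> (nat \<Rightarrow> real) \<Rightarrow> real" where
  "walk_min 0 z = 0"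
| "walk_min (Suc n) z = min 0 (z 0 + walk_min n (\<lambda>k. z (Suc k)))"

lemma walk_min_nonpos: "walk_min n z \<le> 0"
  by (cases n) auto

lemma walk_min_Suc_le: "walk_min (Suc n) z \<le> walk_min n z"
proof (induction n arbitrary: z)
  case 0
  show ?case by simp
next
  case (Suc n)
  show ?case
    using Suc[of "\<lambda>k. z (Suc k)"] by (auto simp: min_def)
qed

lemma walk_min_antimono: "m \<le> n \<Longrightarrow> walk_min n z \<le> walk_min m z"
  by (rule lift_Suc_antimono_le[of "\<lambda>n. walk_min n z"]) (auto intro: walk_min_Suc_le simp del: walk_min.simps)

lemma walk_min_le_sum: "walk_min n z \<le> (\<Sum>k<n. z k)"
proof (induction n arbitrary: z)
  case (Suc n)
  show ?case
    using Suc[of "\<lambda>k. z (Suc k)"] by (simp add: sum.lessThan_Suc_shift del: sum.lessThan_Suc)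
qed simp

lemma walk_min_ge: "- (\<Sum>k<n. \<bar>z k\<bar>) \<le> walk_min n z"
proof (induction n arbitrary: z)
  case (Suc n)
  have "0 \<le> (\<Sum>k<n. \<bar>z (Suc k)\<bar>)" by (rule sum_nonneg) auto
  moreover have "- \<bar>z 0\<bar> \<le> z 0" by simp
  ultimately show ?case
    using Suc[of "\<lambda>k. z (Suc k)"]
    by (simp only: walk_min.simps sum.lessThan_Suc_shift min.bounded_iff) linarith
qed simp

lemma walk_min_case_nat: "walk_min (Suc n) (case_nat a z) = min 0 (a + walk_min n z)"
  by simp

lemma measurable_walk_min [measurable]:
  "walk_min n \<in> borel_measurable (\<Pi>\<^sub>M i\<in>UNIV. borel)"
proof (induction n)
  case (Suc n)
  have shift: "(\<lambda>(z :: nat \<Rightarrow> real) k. z (Suc k)) \<in> (\<Pi>\<^sub>M i\<in>UNIV. borel) \<rightarrow>\<^sub>M (\<Pi>\<^sub>M i\<in>UNIV. borel :: real measure)"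
    by (intro measurable_PiM_single') (auto simp: space_PiM)
  have [measurable]: "(\<lambda>z. walk_min n (\<lambda>k. z (Suc k))) \<in> borel_measurable (\<Pi>\<^sub>M i\<in>UNIV. borel)"
    by (rule measurable_compose[OF shift Suc])
  have "(\<lambda>z. min 0 (z 0 + walk_min n (\<lambda>k. z (Suc k)))) \<in> borel_measurable (\<Pi>\<^sub>M i\<in>UNIV. borel)"
    by measurable
  then show ?case by (simp only: walk_min.simps)
qed simp

text \<open>
  A random walk whose steps have positive mean is almost surely bounded below.  Let \<open>B\<close> be the
  event that the minima \<open>m n\<close> decrease to \<open>-\<infinity>\<close>; it does not depend on the first step.  On \<open>B\<close> the
  difference between \<open>m (n + 1)\<close> and the minimum \<open>m n\<close> of the shifted walk converges to the first
  step, whereas its integral over \<open>B\<close> is at most 0, since \<open>m (n + 1) \<le> m n\<close> and \<open>m n\<close> has the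
  same law for the walk and its shift.  Hence \<open>P B * E z 0 \<le> 0\<close>.
\<close>
lemma walk_min_bounded_AE:
  fixes \<nu> :: "real measure"
  assumes "prob_space \<nu>" and sets: "sets \<nu> = sets borel"
    and int: "integrable \<nu> (\<lambda>x. x)" and pos: "0 < (\<integral>x. x \<partial>\<nu>)"
  shows "AE z in (\<Pi>\<^sub>M i\<in>(UNIV::nat set). \<nu>). \<exists>c. \<forall>n. c \<le> walk_min n z"
proof -
  interpret nu: prob_space \<nu> by fact
  interpret sequence_space \<nu> by unfold_locales
  note sets[measurable_cong]
  have setsS [measurable_cong]: "sets S = sets (\<Pi>\<^sub>M i\<in>UNIV. borel)"
    by (intro sets_PiM_cong) (auto simp: sets)
  have spS: "space S = UNIV"
    using sets_eq_imp_space_eq[OF sets] by (auto simp: space_PiM)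
  define B where "B = {z :: nat \<Rightarrow> real. \<forall>c::nat. \<exists>n. walk_min n z < - real c}"
  have B [measurable]: "B \<in> sets S"
  proof -
    have "B = {z \<in> space S. \<forall>c::nat. \<exists>n. walk_min n z < - real c}"
      by (simp add: B_def spS)
    also have "\<dots> \<in> sets S" by measurable
    finally show ?thesis .
  qed
  have B_shift: "case_nat a z \<in> B \<longleftrightarrow> z \<in> B" for a z
  proof
    assume L: "case_nat a z \<in> B"
    show "z \<in> B" unfolding B_def
    proof safe
      fix c :: nat
      obtain d :: nat where d: "real d \<ge> real c - a" "real d \<ge> real c" 
        using real_arch_simple[of "max (real c - a) (real c)"] by auto
      from L obtain n where n: "walk_min n (case_nat a z) < - real d"
        by (auto simp: B_def)
      have "n \<noteq> 0" using n by (cases n) auto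
      then obtain m where "n = Suc m" by (cases n) auto
      with n d show "\<exists>n. walk_min n z < - real c"
        by (intro exI[of _ m]) (auto simp: min_def split: if_splits)
    qed
  next
    assume R: "z \<in> B"
    show "case_nat a z \<in> B" unfolding B_def
    proof safe
      fix c :: nat
      obtain d :: nat where d: "real d \<ge> real c + a" 
        using real_arch_simple[of "real c + a"] by auto
      from R obtain n where n: "walk_min n z < - real d"
        by (auto simp: B_def)
      with d show "\<exists>n. walk_min n (case_nat a z) < - real c"
        by (intro exI[of _ "Suc n"]) (auto simp: min_def)
    qed
  qed
  have ind_shift: "indicator B (case_nat a z) = (indicator B z :: real)" for a z
    by (simp add: indicator_def B_shift)
  interpret PS: pair_prob_space \<nu> S ..
  have int_abs: "integrable S (\<lambda>z. \<bar>z k\<bar>)" for k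
  proof -
    have "integrable (distr S \<nu> (\<lambda>z. z k)) (\<lambda>x. \<bar>x\<bar>)"
      using int by (subst PiM_component) auto
    then show ?thesis
      by (subst (asm) integrable_distr_eq) auto
  qed
  have int_min: "integrable S (walk_min n)" for n
  proof (rule Bochner_Integration.integrable_bound[where f="\<lambda>z. \<Sum>k<n. \<bar>z k\<bar>"])
    show "integrable S (\<lambda>z. \<Sum>k<n. \<bar>z k\<bar>)" using int_abs by auto
    show "AE z in S. norm (walk_min n z) \<le> norm (\<Sum>k<n. \<bar>z k\<bar>)"
    proof (rule AE_I2)
      fix z :: "nat \<Rightarrow> real"
      show "norm (walk_min n z) \<le> norm (\<Sum>k<n. \<bar>z k\<bar>)"
        using walk_min_ge[where n=n and z=z] walk_min_nonpos[of n z] sum_nonneg[of "{..<n}" "\<lambda>k. \<bar>z k\<bar>"]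
        by auto
    qed
  qed measurable
  define J where "J n = (\<integral>z. indicator B z * walk_min n z \<partial>S)" for n
  have intJ: "integrable S (\<lambda>z. indicator B z * walk_min n z)" for n
    using integrable_mult_indicator[OF B int_min[of n]] by simp
  have J_dec: "J (Suc n) \<le> J n" for n
    unfolding J_def
    by (intro integral_mono intJ) (auto simp: indicator_def walk_min_Suc_le simp del: walk_min.simps)
  have iter: "distr (\<nu> \<Otimes>\<^sub>M S) S (\<lambda>x. case_nat (fst x) (snd x)) = S"
    using PiM_iter by (simp add: split_beta')
  have meas_shift: "(\<lambda>x. case_nat (fst x) (snd x)) \<in> \<nu> \<Otimes>\<^sub>M S \<rightarrow>\<^sub>M S"
    by measurable
  have meas_ind: "(\<lambda>z. indicator B z * walk_min n z) \<in> borel_measurable S" for n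
    by measurable
  have J_Suc: "J (Suc n) = (\<integral>x. indicator B (snd x) * min 0 (fst x + walk_min n (snd x)) \<partial>(\<nu> \<Otimes>\<^sub>M S))" for n
  proof -
    have "J (Suc n) = (\<integral>z. indicator B z * walk_min (Suc n) z
        \<partial>distr (\<nu> \<Otimes>\<^sub>M S) S (\<lambda>x. case_nat (fst x) (snd x)))"
      unfolding J_def iter ..
    also have "\<dots> = (\<integral>x. indicator B (case_nat (fst x) (snd x)) *
        walk_min (Suc n) (case_nat (fst x) (snd x)) \<partial>(\<nu> \<Otimes>\<^sub>M S))"
      by (rule integral_distr[OF meas_shift meas_ind])
    finally show ?thesis
      unfolding ind_shift walk_min_case_nat .
  qed
  have J_snd: "J n = (\<integral>x. indicator B (snd x) * walk_min n (snd x) \<partial>(\<nu> \<Otimes>\<^sub>M S))" (is ?A)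
    and intJ2: "integrable (\<nu> \<Otimes>\<^sub>M S) (\<lambda>x. indicator B (snd x) * walk_min n (snd x))" (is ?B) for n
  proof -
    have sw: "distr (\<nu> \<Otimes>\<^sub>M S) S snd = S"
    proof (rule measure_eqI)
      fix A assume A: "A \<in> sets (distr (\<nu> \<Otimes>\<^sub>M S) S snd)"
      then have "snd -` A \<inter> space (\<nu> \<Otimes>\<^sub>M S) = space \<nu> \<times> A"
        using sets.sets_into_space[of A S] by (auto simp: space_pair_measure)
      with A show "emeasure (distr (\<nu> \<Otimes>\<^sub>M S) S snd) A = emeasure S A"
        by (simp add: emeasure_distr P.emeasure_pair_measure_Times nu.emeasure_space_1)
    qed simp
    have "J n = (\<integral>z. indicator B z * walk_min n z \<partial>(distr (\<nu> \<Otimes>\<^sub>M S) S snd))"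
      unfolding J_def sw ..
    also have "\<dots> = (\<integral>x. indicator B (snd x) * walk_min n (snd x) \<partial>(\<nu> \<Otimes>\<^sub>M S))"
      by (rule integral_distr[OF measurable_snd meas_ind])
    finally show ?A .
    show ?B
      by (rule integrable_distr[OF measurable_snd]) (simp only: sw intJ)
  qed
  have sw: "distr (\<nu> \<Otimes>\<^sub>M S) \<nu> fst = \<nu>"
    by (rule P.distr_pair_fst)
  have int_fst: "integrable (\<nu> \<Otimes>\<^sub>M S) (\<lambda>x. fst x)"
    by (rule integrable_distr[OF measurable_fst]) (simp only: sw int)
  \<comment> \<open>On \<open>B\<close> the integrand equals the first step as soon as the minimum lies below its negative.\<close>
  have dom: "(\<lambda>n. \<integral>x. indicator B (snd x) * min (- walk_min n (snd x)) (fst x) \<partial>(\<nu> \<Otimes>\<^sub>M S))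
      \<longlonglongrightarrow> (\<integral>x. indicator B (snd x) * fst x \<partial>(\<nu> \<Otimes>\<^sub>M S))"
  proof (rule integral_dominated_convergence[where w="\<lambda>x. \<bar>fst x\<bar>"])
    show "AE x in \<nu> \<Otimes>\<^sub>M S. (\<lambda>n. indicator B (snd x) * min (- walk_min n (snd x)) (fst x))
        \<longlonglongrightarrow> indicator B (snd x) * fst x"
    proof (rule AE_I2)
      fix x :: "real \<times> (nat \<Rightarrow> real)"
      show "(\<lambda>n. indicator B (snd x) * min (- walk_min n (snd x)) (fst x))
          \<longlonglongrightarrow> indicator B (snd x) * fst x"
      proof (cases "snd x \<in> B")
        case True
        obtain c :: nat where c: "fst x \<le> real c" using real_arch_simple by blast
        from True obtain m where m: "walk_min m (snd x) < - real c" by (auto simp: B_def)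
        have "eventually (\<lambda>n. fst x = min (- walk_min n (snd x)) (fst x)) sequentially"
          using eventually_ge_at_top[of m]
        proof eventually_elim
          case (elim n)
          then show ?case
            using walk_min_antimono[of m n "snd x"] m c by (auto simp: min_def)
        qed
        then have "(\<lambda>n. min (- walk_min n (snd x)) (fst x)) \<longlonglongrightarrow> fst x"
          by (rule Lim_transform_eventually[OF tendsto_const])
        then show ?thesis by (intro tendsto_mult tendsto_const)
      qed simp
    qed
    show "AE x in \<nu> \<Otimes>\<^sub>M S. norm (indicator B (snd x) * min (- walk_min n (snd x)) (fst x)) \<le> \<bar>fst x\<bar>" for n
    proof (rule AE_I2)
      fix x :: "real \<times> (nat \<Rightarrow> real)"
      show "norm (indicator B (snd x) * min (- walk_min n (snd x)) (fst x)) \<le> \<bar>fst x\<bar>"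
        using walk_min_nonpos[of n "snd x"] by (auto simp: indicator_def min_def)
    qed
  qed (use int_fst in auto)
  have le0: "(\<integral>x. indicator B (snd x) * min (- walk_min n (snd x)) (fst x) \<partial>(\<nu> \<Otimes>\<^sub>M S)) \<le> 0" for n
  proof -
    have eq: "indicator B (snd x) * min (- walk_min n (snd x)) (fst x) =
        indicator B (snd x) * min 0 (fst x + walk_min n (snd x)) - indicator B (snd x) * walk_min n (snd x)"
      for x :: "real \<times> (nat \<Rightarrow> real)"
      by (auto simp: indicator_def min_def)
    have int3: "integrable (\<nu> \<Otimes>\<^sub>M S) (\<lambda>x. indicator B (snd x) * min 0 (fst x + walk_min n (snd x)))"
    proof (rule Bochner_Integration.integrable_bound[where f="\<lambda>x. \<bar>fst x\<bar> + \<bar>indicator B (snd x) * walk_min n (snd x)\<bar>"])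
      show "AE x in \<nu> \<Otimes>\<^sub>M S. norm (indicator B (snd x) * min 0 (fst x + walk_min n (snd x))) \<le>
          norm (\<bar>fst x\<bar> + \<bar>indicator B (snd x) * walk_min n (snd x)\<bar>)"
        by (rule AE_I2) (auto simp: indicator_def min_def)
    qed (use int_fst intJ2[of n] in auto)
    have "(\<integral>x. indicator B (snd x) * min (- walk_min n (snd x)) (fst x) \<partial>(\<nu> \<Otimes>\<^sub>M S)) = J (Suc n) - J n"
      unfolding eq J_Suc J_snd[of n] by (rule Bochner_Integration.integral_diff[OF int3 intJ2])
    with J_dec[of n] show ?thesis by simp
  qed
  have "(\<integral>x. indicator B (snd x) * fst x \<partial>(\<nu> \<Otimes>\<^sub>M S)) \<le> 0"
    using dom le0 by (intro LIMSEQ_le_const2) auto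
  moreover have "(\<integral>x. indicator B (snd x) * fst x \<partial>(\<nu> \<Otimes>\<^sub>M S)) = measure S B * (\<integral>x. x \<partial>\<nu>)"
  proof -
    have "integrable (\<nu> \<Otimes>\<^sub>M S) (\<lambda>(a, z). indicator B z * a)"
    proof (rule Bochner_Integration.integrable_bound[OF int_fst])
      show "AE x in \<nu> \<Otimes>\<^sub>M S. norm (case x of (a, z) \<Rightarrow> indicator B z * a) \<le> norm (fst x)"
        by (rule AE_I2) (auto simp: indicator_def)
    qed measurable
    from PS.integral_fst'[OF this]
    have "(\<integral>x. indicator B (snd x) * fst x \<partial>(\<nu> \<Otimes>\<^sub>M S)) = (\<integral>a. \<integral>z. indicator B z * a \<partial>S \<partial>\<nu>)"
      by (simp add: split_beta')
    also have "\<dots> = (\<integral>a. measure S B * a \<partial>\<nu>)"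
      by simp
    also have "\<dots> = measure S B * (\<integral>x. x \<partial>\<nu>)"
      by simp
    finally show ?thesis .
  qed
  ultimately have "measure S B = 0"
    using pos measure_nonneg[of S B] by (simp add: mult_le_0_iff)
  then have "B \<in> null_sets S"
    by (auto simp: null_sets_def P.emeasure_eq_measure)
  then have "AE z in S. z \<notin> B" by (rule AE_not_in)
  then show ?thesis
  proof eventually_elim
    case (elim z)
    then obtain c :: nat where "\<not> (\<exists>n. walk_min n z < - real c)" by (auto simp: B_def)
    then show ?case by (intro exI[of _ "- real c"]) (auto simp: not_less)
  qed
qed

text \<open>The expectation may be infinite; truncation from above makes it finite and keeps it positive.\<close>
lemma positive_expectation_truncation:
  assumes "prob_space M" and ex: "expectation_exists M f" and pos: "ext_expectation M f > 0"
  obtains c :: nat where "integrable M (\<lambda>x. min (f x) (real c))" "0 < (\<integral>x. min (f x) (real c) \<partial>M)"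
proof -
  interpret prob_space M by fact
  define a b where "a = (\<integral>\<^sup>+x. ennreal (f x) \<partial>M)" and "b = (\<integral>\<^sup>+x. ennreal (- f x) \<partial>M)"
  have [measurable]: "f \<in> borel_measurable M" and fin: "a < \<infinity> \<or> b < \<infinity>"
    using ex by (auto simp: expectation_exists_def a_def b_def)
  have ab: "enn2ereal a - enn2ereal b > 0"
    using pos by (simp add: ext_expectation_def a_def b_def)
  have b_fin: "b < \<infinity>"
  proof (rule ccontr)
    assume "\<not> b < \<infinity>"
    then have b: "b = \<infinity>" using less_top[of b] by auto
    with fin obtain r where "a = ennreal r" "0 \<le> r" by (cases a) auto
    with ab b show False by simp
  qed
  have "b < a"
  proof -
    obtain r where r: "b = ennreal r" "0 \<le> r" using b_fin by (cases b) auto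
    show ?thesis
    proof (cases a)
      case (real s)
      with ab r show ?thesis by (simp add: ennreal_less_iff)
    next
      case top
      with b_fin show ?thesis by simp
    qed
  qed
  have "a = (SUP c::nat. \<integral>\<^sup>+x. ennreal (min (f x) (real c)) \<partial>M)"
    unfolding a_def
  proof (subst nn_integral_monotone_convergence_SUP[symmetric])
    show "incseq (\<lambda>c x. ennreal (min (f x) (real c)))"
      by (auto simp: incseq_def le_fun_def intro!: ennreal_leI)
    show "(\<integral>\<^sup>+x. ennreal (f x) \<partial>M) = (\<integral>\<^sup>+x. (SUP c::nat. ennreal (min (f x) (real c))) \<partial>M)"
    proof (intro nn_integral_cong antisym)
      fix x
      obtain c :: nat where "f x \<le> real c" using real_arch_simple by blast
      then show "ennreal (f x) \<le> (SUP c::nat. ennreal (min (f x) (real c)))"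
        by (intro SUP_upper2[of c]) auto
      show "(SUP c::nat. ennreal (min (f x) (real c))) \<le> ennreal (f x)"
        by (intro SUP_least ennreal_leI) auto
    qed
  qed measurable
  with \<open>b < a\<close> obtain c :: nat where c: "b < (\<integral>\<^sup>+x. ennreal (min (f x) (real c)) \<partial>M)"
    by (auto simp: less_SUP_iff)
  have neg: "(\<integral>\<^sup>+x. ennreal (- min (f x) (real c)) \<partial>M) = b"
    unfolding b_def by (intro nn_integral_cong) (auto simp: min_def ennreal_neg)
  have fin_c: "(\<integral>\<^sup>+x. ennreal (min (f x) (real c)) \<partial>M) < \<infinity>"
  proof -
    have "(\<integral>\<^sup>+x. ennreal (min (f x) (real c)) \<partial>M) \<le> (\<integral>\<^sup>+x. ennreal (real c) \<partial>M)"
      by (intro nn_integral_mono ennreal_leI) auto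
    also have "\<dots> < \<infinity>" by (simp add: emeasure_space_1)
    finally show ?thesis .
  qed
  have int: "integrable M (\<lambda>x. min (f x) (real c))"
    using neg b_fin fin_c by (auto simp: real_integrable_def)
  moreover have "0 < (\<integral>x. min (f x) (real c) \<partial>M)"
    unfolding real_lebesgue_integral_def[OF int] neg
    using c b_fin fin_c by (simp add: enn2real_less_iff less_top)
  ultimately show thesis by (rule that)
qed

text \<open>
  The product of the first \<open>n\<close> ratios \<open>(1 - P k) / P k\<close> is \<open>exp\<close> of minus a random walk.  Part of the drift
  is set aside as \<open>e\<close>: the walk whose steps are truncated and reduced by \<open>e\<close> is still bounded below, so
  the products are at most a constant times \<open>exp (- e) ^ n\<close>.
\<close>
lemma AE_summable_prod_odds:
  fixes P :: "nat \<Rightarrow> 'a \<Rightarrow> real"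
  assumes "prob_space M" and indep: "prob_space.indep_vars M (\<lambda>_. borel) P UNIV"
    and ident: "\<And>k. distr M borel (P k) = distr M borel (P 0)"
    and unit: "\<And>k \<omega>. \<omega> \<in> space M \<Longrightarrow> 0 < P k \<omega> \<and> P k \<omega> < 1"
    and ex: "expectation_exists M (\<lambda>\<omega>. ln (P 0 \<omega> / (1 - P 0 \<omega>)))"
    and pos: "ext_expectation M (\<lambda>\<omega>. ln (P 0 \<omega> / (1 - P 0 \<omega>))) > 0"
  shows "AE \<omega> in M. summable (\<lambda>n. \<Prod>k<n. (1 - P k \<omega>) / P k \<omega>)"
proof -
  interpret prob_space M by fact
  obtain c :: nat where int: "integrable M (\<lambda>\<omega>. min (ln (P 0 \<omega> / (1 - P 0 \<omega>))) (real c))"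
    and pos: "0 < (\<integral>\<omega>. min (ln (P 0 \<omega> / (1 - P 0 \<omega>))) (real c) \<partial>M)"
    using positive_expectation_truncation[OF \<open>prob_space M\<close> ex pos] by blast
  define e where "e = (\<integral>\<omega>. min (ln (P 0 \<omega> / (1 - P 0 \<omega>))) (real c) \<partial>M) / 2"
  have e: "0 < e" using pos by (simp add: e_def)
  define g where "g x = min (ln (x / (1 - x))) (real c) - e" for x :: real
  have [measurable]: "g \<in> borel_measurable borel" by (simp add: g_def[abs_def])
  have rv [measurable]: "P k \<in> borel_measurable M" for k
    using indep by (auto simp: indep_vars_def)
  define Z where "Z k \<omega> = g (P k \<omega>)" for k \<omega>
  have rvZ [measurable]: "Z k \<in> borel_measurable M" for k by (simp add: Z_def[abs_def])
  have "indep_vars (\<lambda>_. borel) Z UNIV"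
    unfolding Z_def[abs_def] by (rule indep_vars_compose2[OF indep]) simp
  then have law: "distr M (\<Pi>\<^sub>M i\<in>UNIV. borel) (\<lambda>\<omega>. \<lambda>i\<in>UNIV. Z i \<omega>) = (\<Pi>\<^sub>M i\<in>UNIV. distr M borel (Z i))"
    by (subst (asm) indep_vars_iff_distr_eq_PiM') auto
  define \<nu> where "\<nu> = distr M borel (Z 0)"
  have "distr M borel (Z k) = \<nu>" for k
  proof -
    have "distr M borel (Z k) = distr (distr M borel (P k)) borel g"
      by (subst distr_distr) (auto simp: Z_def[abs_def] comp_def)
    also have "\<dots> = distr (distr M borel (P 0)) borel g" by (simp only: ident[of k])
    also have "\<dots> = \<nu>"
      by (subst distr_distr) (auto simp: Z_def[abs_def] comp_def \<nu>_def)
    finally show ?thesis .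
  qed
  with law have law: "distr M (\<Pi>\<^sub>M i\<in>UNIV. borel) (\<lambda>\<omega>. \<lambda>i\<in>UNIV. Z i \<omega>) = (\<Pi>\<^sub>M i\<in>UNIV. \<nu>)"
    by simp
  have Z0: "integrable M (Z 0)" "0 < (\<integral>\<omega>. Z 0 \<omega> \<partial>M)"
    using int e by (auto simp: Z_def[abs_def] g_def prob_space) (simp add: e_def)
  have "AE z in (\<Pi>\<^sub>M i\<in>(UNIV::nat set). \<nu>). \<exists>c. \<forall>n. c \<le> walk_min n z"
  proof (rule walk_min_bounded_AE)
    show "prob_space \<nu>" unfolding \<nu>_def by (rule prob_space_distr) simp
  qed (use Z0 in \<open>auto simp: \<nu>_def integrable_distr_eq integral_distr\<close>)
  then have "AE \<omega> in M. \<exists>c. \<forall>n. c \<le> walk_min n (\<lambda>i\<in>UNIV. Z i \<omega>)"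
    unfolding law[symmetric] by (rule AE_distrD[rotated]) measurable
  with AE_space show ?thesis
  proof eventually_elim
    case (elim \<omega>)
    then obtain c0 where c0: "\<And>n. c0 \<le> walk_min n (\<lambda>i. Z i \<omega>)" by (auto simp: restrict_UNIV)
    have bound: "(\<Prod>k<n. (1 - P k \<omega>) / P k \<omega>) \<le> exp (- c0) * exp (- e) ^ n" for n
    proof -
      have "(\<Prod>k<n. (1 - P k \<omega>) / P k \<omega>) = (\<Prod>k<n. exp (- ln (P k \<omega> / (1 - P k \<omega>))))"
        using unit[OF elim(1)] by (intro prod.cong refl) (simp add: exp_minus)
      also have "\<dots> \<le> (\<Prod>k<n. exp (- (Z k \<omega> + e)))"
        by (intro prod_mono) (auto simp: Z_def g_def)
      also have "\<dots> = exp (- (\<Sum>k<n. Z k \<omega>)) * exp (- e) ^ n"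
        by (simp add: exp_sum[symmetric] exp_of_nat_mult[symmetric] mult_exp_exp sum_negf sum.distrib
          sum_subtractf)
      also have "\<dots> \<le> exp (- c0) * exp (- e) ^ n"
        using order_trans[OF c0 walk_min_le_sum, of n] by (intro mult_right_mono) auto
      finally show ?thesis .
    qed
    show ?case
    proof (rule summable_comparison_test')
      show "summable (\<lambda>n. exp (- c0) * exp (- e) ^ n)"
        using e by (intro summable_mult summable_geometric) simp
      show "norm (\<Prod>k<n. (1 - P k \<omega>) / P k \<omega>) \<le> exp (- c0) * exp (- e) ^ n" if "0 \<le> n" for n
        using bound[of n] unit[OF elim(1)] by (simp add: abs_prod less_imp_le)
    qed
  qed
qed

section \<open>The one-particle chain\<close>

text \<open>The \<open>n\<close>-step transition probabilities of the jump chain, by decomposition at the first jump.\<close>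

primrec step_prob :: "(int \<Rightarrow> real) \<Rightarrow> nat \<Rightarrow> int \<Rightarrow> int \<Rightarrow> real" where
  "step_prob p 0 i j = of_bool (i = j)"
| "step_prob p (Suc n) i j = p i * step_prob p n (i + 1) j + (1 - p i) * step_prob p n (i - 1) j"

text \<open>Reflection is a symmetry of the transition probabilities.  It is not a pathwise symmetry of
  \<open>jump_chain\<close>, whose rule for jumping to the right is a strict inequality.\<close>
lemma step_prob_mirror:
  "step_prob (\<lambda>i. 1 - p (- i)) n (- i) (- j) = step_prob p n i j"
proof (induction n arbitrary: i)
  case (Suc n)
  have "- (i + 1) = - i - 1" "- (i - 1) = - i + 1" by simp_all
  with Suc[of "i + 1"] Suc[of "i - 1"] show ?case by simp
qed simp

text \<open>The law of the holding time and the direction variable of a single jump.\<close>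
abbreviation jump_noise :: "(real \<times> real) measure" where
  "jump_noise \<equiv> density lborel (exponential_density 1) \<Otimes>\<^sub>M uniform_measure lborel {0..1}"

lemma prob_space_holding: "prob_space (density lborel (exponential_density 1))"
  by (rule prob_space_exponential_density) simp

lemma prob_space_direction: "prob_space (uniform_measure lborel {0..1::real})"
  by (rule prob_space_uniform_measure) auto

lemma prob_space_jump_noise: "prob_space jump_noise"
  by (intro prob_space_pair prob_space_holding prob_space_direction)

lemma sets_noise_space [measurable_cong]: "sets noise_space = sets (\<Pi>\<^sub>M n\<in>UNIV. borel)"
  unfolding noise_space_def by (intro sets_PiM_cong refl) (simp add: borel_prod[symmetric] cong: sets_pair_measure_cong)

lemma space_noise_space [simp]: "space noise_space = UNIV"
  by (simp add: noise_space_def space_PiM space_pair_measure)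

lemma prob_space_noise_space: "prob_space noise_space"
  unfolding noise_space_def by (intro prob_space_PiM prob_space_jump_noise)

text \<open>Splitting off the first jump: the remaining noise has the same law and is independent of it.\<close>
lemma nn_integral_noise_space_shift:
  assumes [measurable]: "F \<in> borel_measurable noise_space"
  shows "(\<integral>\<^sup>+w. F w \<partial>noise_space) = (\<integral>\<^sup>+x. \<integral>\<^sup>+w. F (case_nat x w) \<partial>noise_space \<partial>jump_noise)"
proof -
  interpret N: prob_space jump_noise by (rule prob_space_jump_noise)
  interpret sequence_space jump_noise by unfold_locales
  have S: "noise_space = S" by (simp add: noise_space_def)
  have iter: "distr (jump_noise \<Otimes>\<^sub>M S) S (\<lambda>x. case_nat (fst x) (snd x)) = S"
    using PiM_iter by (simp add: split_beta')
  have F: "F \<in> borel_measurable S" using assms by (simp add: S)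
  have shift: "(\<lambda>x. case_nat (fst x) (snd x)) \<in> jump_noise \<Otimes>\<^sub>M S \<rightarrow>\<^sub>M S" by measurable
  have "(\<integral>\<^sup>+w. F w \<partial>S) = (\<integral>\<^sup>+w. F w \<partial>distr (jump_noise \<Otimes>\<^sub>M S) S (\<lambda>x. case_nat (fst x) (snd x)))"
    by (simp only: iter)
  also have "\<dots> = (\<integral>\<^sup>+x. F (case_nat (fst x) (snd x)) \<partial>(jump_noise \<Otimes>\<^sub>M S))"
    by (rule nn_integral_distr[OF shift]) (use F in simp)
  also have "\<dots> = (\<integral>\<^sup>+x. \<integral>\<^sup>+w. F (case_nat x w) \<partial>S \<partial>jump_noise)"
    using P.nn_integral_fst[OF measurable_compose[OF shift F]] by simp
  finally show ?thesis by (simp only: S)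
qed

lemma jump_chain_case_nat:
  "jump_chain p i (case_nat x w) (Suc n) = jump_chain p (if snd x < p i then i + 1 else i - 1) w n"
  by (induction n) auto

lemma measurable_noise_components [measurable]:
  "(\<lambda>w. fst (w n)) \<in> borel_measurable noise_space" "(\<lambda>w. snd (w n)) \<in> borel_measurable noise_space"
proof -
  have w: "(\<lambda>w. w n) \<in> noise_space \<rightarrow>\<^sub>M (borel \<Otimes>\<^sub>M borel)"
    unfolding borel_prod by measurable
  show "(\<lambda>w. fst (w n)) \<in> borel_measurable noise_space" "(\<lambda>w. snd (w n)) \<in> borel_measurable noise_space"
    by (rule measurable_compose[OF w measurable_fst] measurable_compose[OF w measurable_snd])+
qed

lemma measurable_jump_chain [measurable]:
  "(\<lambda>w. jump_chain p i w n) \<in> noise_space \<rightarrow>\<^sub>M count_space UNIV"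
proof (induction n)
  case (Suc n)
  note Suc [measurable]
  show ?case by simp
qed simp

lemma measurable_indicator_jump_chain [measurable]:
  "(\<lambda>w. indicator {j} (jump_chain p i w n) :: ennreal) \<in> borel_measurable noise_space"
  by (rule measurable_compose[OF measurable_jump_chain]) simp

text \<open>\<open>jump_count\<close> as a function of the sequence of holding times alone.\<close>
definition count_upto :: "real \<Rightarrow> (nat \<Rightarrow> real) \<Rightarrow> nat" where
  "count_upto t a = card {n. (\<Sum>k\<le>n. a k) \<le> t}"

lemma jump_count_eq: "jump_count w t = count_upto t (\<lambda>n. fst (w n))"
  by (simp add: jump_count_def count_upto_def)

lemma measurable_count_upto [measurable]:
  "count_upto t \<in> (\<Pi>\<^sub>M n\<in>UNIV. borel) \<rightarrow>\<^sub>M count_space UNIV"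
  unfolding count_upto_def by measurable

lemma measurable_indicator_count_upto [measurable]:
  "(\<lambda>a. indicator {m} (count_upto t a) :: ennreal) \<in> borel_measurable (\<Pi>\<^sub>M n\<in>UNIV. borel)"
  by (rule measurable_compose[OF measurable_count_upto]) simp

lemma measurable_holding_times [measurable]:
  "(\<lambda>w n. fst (w n)) \<in> noise_space \<rightarrow>\<^sub>M (\<Pi>\<^sub>M n\<in>UNIV. borel)"
  by (intro measurable_PiM_single') (auto simp: space_PiM)

lemma measurable_jump_count [measurable]:
  "(\<lambda>w. jump_count w t) \<in> noise_space \<rightarrow>\<^sub>M count_space UNIV"
  unfolding jump_count_eq by measurable

lemma measurable_position [measurable]:
  "(\<lambda>w. position p i w t) \<in> noise_space \<rightarrow>\<^sub>M count_space UNIV"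
  unfolding position_def by (rule measurable_compose_countable) measurable

lemma position_event: "{w. position p i w t = j} \<in> sets noise_space"
proof -
  have "{w \<in> space noise_space. position p i w t = j} \<in> sets noise_space" by measurable
  then show ?thesis by simp
qed

lemma jump_count_event: "{w. jump_count w t = m} \<in> sets noise_space"
proof -
  have "{w \<in> space noise_space. jump_count w t = m} \<in> sets noise_space" by measurable
  then show ?thesis by simp
qed

text \<open>A fixed, deterministic environment.\<close>
locale environment =
  fixes p :: "int \<Rightarrow> real"
  assumes p_pos: "\<And>i. 0 < p i" and p_less_1: "\<And>i. p i < 1"
begin

lemma step_prob_nonneg: "0 \<le> step_prob p n i j"
  by (induction n arbitrary: i) (auto intro!: add_nonneg_nonneg mult_nonneg_nonneg less_imp_le[OF p_pos] less_imp_le[OF p_less_1])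

lemma nn_integral_direction:
  assumes "0 \<le> a" "0 \<le> b"
  shows "(\<integral>\<^sup>+u. ennreal (if u < p i then a else b) \<partial>uniform_measure lborel {0..1}) =
    ennreal (p i * a + (1 - p i) * b)"
proof -
  have "(\<integral>\<^sup>+u. ennreal (if u < p i then a else b) \<partial>uniform_measure lborel {0..1}) =
      (\<integral>\<^sup>+u. ennreal (if u < p i then a else b) * indicator {0..1} u \<partial>lborel)"
    by (subst nn_integral_uniform_measure) (auto simp: divide_ennreal_def)
  also have "\<dots> = (\<integral>\<^sup>+u. ennreal a * indicator {0..<p i} u + ennreal b * indicator {p i..1} u \<partial>lborel)"
    using p_pos[of i] p_less_1[of i] by (intro nn_integral_cong) (auto simp: indicator_def)
  also have "\<dots> = ennreal a * ennreal (p i) + ennreal b * ennreal (1 - p i)"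
    using p_pos[of i] p_less_1[of i] by (subst nn_integral_add) (auto simp: nn_integral_cmult_indicator)
  also have "\<dots> = ennreal (p i * a + (1 - p i) * b)"
    using assms p_pos[of i] p_less_1[of i] by (simp add: ennreal_plus ennreal_mult mult.commute)
  finally show ?thesis .
qed

text \<open>The jump chain is independent of the holding times: functionals \<open>H\<close> of the latter factor out.\<close>
lemma nn_integral_jump_chain:
  assumes "H \<in> borel_measurable (\<Pi>\<^sub>M n\<in>UNIV. borel)"
  shows "(\<integral>\<^sup>+w. H (\<lambda>n. fst (w n)) * indicator {j} (jump_chain p i w n) \<partial>noise_space) =
    ennreal (step_prob p n i j) * (\<integral>\<^sup>+w. H (\<lambda>n. fst (w n)) \<partial>noise_space)"
  using assms
proof (induction n arbitrary: i H)
  case 0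
  show ?case by (cases "i = j") auto
next
  case (Suc n)
  note Suc.prems [measurable]
  have fst_case: "(\<lambda>n. fst (case_nat x w n)) = case_nat (fst x) (\<lambda>n. fst (w n))"
    for x :: "real \<times> real" and w :: "nat \<Rightarrow> real \<times> real"
    by (auto simp: fun_eq_iff split: nat.split)
  have [measurable]: "(\<lambda>f. H (case_nat a f)) \<in> borel_measurable (\<Pi>\<^sub>M n\<in>UNIV. borel)" for a
    by measurable
  define K where "K a = (\<integral>\<^sup>+w. H (case_nat a (\<lambda>n. fst (w n))) \<partial>noise_space)" for a
  interpret N: prob_space noise_space by (rule prob_space_noise_space)
  interpret U: prob_space "uniform_measure lborel {0..1::real}" by (rule prob_space_direction)
  have [measurable]: "(\<lambda>x. case_nat (fst x) (\<lambda>n. fst (snd x n))) \<in> borel \<Otimes>\<^sub>M noise_space \<rightarrow>\<^sub>M (\<Pi>\<^sub>M n\<in>UNIV. borel)"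
    by measurable
  have [measurable]: "K \<in> borel_measurable borel"
    unfolding K_def using N.borel_measurable_nn_integral_fst[of "\<lambda>x. H (case_nat (fst x) (\<lambda>n. fst (snd x n)))" borel]
    by simp
  define s where "s u = (if u < p i then step_prob p n (i + 1) j else step_prob p n (i - 1) j)" for u
  have [measurable]: "s \<in> borel_measurable borel" unfolding s_def by measurable
  have meas: "(\<lambda>w. H (\<lambda>n. fst (w n)) * indicator {j} (jump_chain p i w (Suc n))) \<in> borel_measurable noise_space"
    "(\<lambda>w. H (\<lambda>n. fst (w n))) \<in> borel_measurable noise_space"
    by (intro borel_measurable_times_ennreal measurable_indicator_jump_chain
      measurable_compose[OF measurable_holding_times Suc.prems])+
  have "(\<integral>\<^sup>+w. H (\<lambda>n. fst (w n)) * indicator {j} (jump_chain p i w (Suc n)) \<partial>noise_space) =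
      (\<integral>\<^sup>+x. \<integral>\<^sup>+w. H (case_nat (fst x) (\<lambda>n. fst (w n))) *
        indicator {j} (jump_chain p (if snd x < p i then i + 1 else i - 1) w n) \<partial>noise_space \<partial>jump_noise)"
    unfolding nn_integral_noise_space_shift[OF meas(1)] fst_case jump_chain_case_nat ..
  also have "\<dots> = (\<integral>\<^sup>+x. ennreal (s (snd x)) * K (fst x) \<partial>jump_noise)"
    by (intro nn_integral_cong, subst Suc.IH) (auto simp: K_def s_def)
  also have "\<dots> = (\<integral>\<^sup>+a. \<integral>\<^sup>+u. ennreal (s u) * K a \<partial>uniform_measure lborel {0..1} \<partial>density lborel (exponential_density 1))"
    by (subst U.nn_integral_fst[symmetric]) auto
  also have "\<dots> = (\<integral>\<^sup>+a. ennreal (step_prob p (Suc n) i j) * K a \<partial>density lborel (exponential_density 1))"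
    by (intro nn_integral_cong) (simp add: nn_integral_multc s_def nn_integral_direction step_prob_nonneg)
  also have "\<dots> = ennreal (step_prob p (Suc n) i j) * (\<integral>\<^sup>+a. K a \<partial>density lborel (exponential_density 1))"
    by (rule nn_integral_cmult) simp
  also have "(\<integral>\<^sup>+a. K a \<partial>density lborel (exponential_density 1)) =
      (\<integral>\<^sup>+a. \<integral>\<^sup>+u. K a \<partial>uniform_measure lborel {0..1::real} \<partial>density lborel (exponential_density 1))"
    by (simp add: U.emeasure_space_1[simplified])
  also have "\<dots> = (\<integral>\<^sup>+x. K (fst x) \<partial>jump_noise)"
    by (subst U.nn_integral_fst[symmetric]) auto
  also have "\<dots> = (\<integral>\<^sup>+w. H (\<lambda>n. fst (w n)) \<partial>noise_space)"
    unfolding nn_integral_noise_space_shift[OF meas(2)] fst_case K_def ..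
  finally show ?case .
qed

text \<open>The transition probabilities of the continuous-time chain.\<close>
definition hop_prob :: "real \<Rightarrow> int \<Rightarrow> int \<Rightarrow> real" where
  "hop_prob t i j = measure noise_space {w. position p i w t = j}"

text \<open>The law of the number of jumps up to time \<open>t\<close>.\<close>
definition count_prob :: "real \<Rightarrow> nat \<Rightarrow> real" where
  "count_prob t m = measure noise_space {w. jump_count w t = m}"

lemma ennreal_hop_prob:
  "ennreal (hop_prob t i j) = (\<Sum>m. ennreal (count_prob t m) * ennreal (step_prob p m i j))"
proof -
  interpret N: prob_space noise_space by (rule prob_space_noise_space)
  have cp: "(\<integral>\<^sup>+w. indicator {m} (count_upto t (\<lambda>n. fst (w n))) \<partial>noise_space) = ennreal (count_prob t m)" for m
  proof -
    have "(\<integral>\<^sup>+w. indicator {m} (count_upto t (\<lambda>n. fst (w n))) \<partial>noise_space) =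
        (\<integral>\<^sup>+w. indicator {w. jump_count w t = m} w \<partial>noise_space)"
      by (intro nn_integral_cong) (auto simp: jump_count_eq indicator_def)
    then show ?thesis by (simp add: count_prob_def N.emeasure_eq_measure[symmetric] jump_count_event)
  qed
  have "ennreal (hop_prob t i j) = (\<integral>\<^sup>+w. indicator {w. position p i w t = j} w \<partial>noise_space)"
    by (simp add: hop_prob_def N.emeasure_eq_measure[symmetric] position_event)
  also have "\<dots> = (\<integral>\<^sup>+w. (\<Sum>m. indicator {m} (count_upto t (\<lambda>n. fst (w n))) *
      indicator {j} (jump_chain p i w m)) \<partial>noise_space)"
  proof (intro nn_integral_cong)
    fix w :: "nat \<Rightarrow> real \<times> real"
    let ?m = "count_upto t (\<lambda>n. fst (w n))"
    have "(\<Sum>m. indicator {m} ?m * indicator {j} (jump_chain p i w m) :: ennreal) =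
        (\<Sum>m\<in>{?m}. indicator {m} ?m * indicator {j} (jump_chain p i w m))"
      by (rule suminf_finite) auto
    then show "indicator {w. position p i w t = j} w = (\<Sum>m. indicator {m} ?m *
        indicator {j} (jump_chain p i w m) :: ennreal)"
      by (auto simp: position_def jump_count_eq indicator_def)
  qed
  also have "\<dots> = (\<Sum>m. \<integral>\<^sup>+w. indicator {m} (count_upto t (\<lambda>n. fst (w n))) *
      indicator {j} (jump_chain p i w m) \<partial>noise_space)"
    by (intro nn_integral_suminf borel_measurable_times_ennreal measurable_indicator_jump_chain
      measurable_compose[OF measurable_holding_times measurable_indicator_count_upto])
  also have "\<dots> = (\<Sum>m. ennreal (step_prob p m i j) *
      (\<integral>\<^sup>+w. indicator {m} (count_upto t (\<lambda>n. fst (w n))) \<partial>noise_space))"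
    by (subst nn_integral_jump_chain[where H="\<lambda>a. indicator {_} (count_upto t a)"]) auto
  also have "\<dots> = (\<Sum>m. ennreal (step_prob p m i j) * ennreal (count_prob t m))"
    by (simp only: cp)
  finally show ?thesis by (simp add: mult.commute)
qed

lemma suminf_count_prob: "(\<Sum>m. ennreal (count_prob t m)) = 1"
proof -
  interpret N: prob_space noise_space by (rule prob_space_noise_space)
  have "(\<Sum>m. emeasure noise_space {w. jump_count w t = m}) = emeasure noise_space (\<Union>m. {w. jump_count w t = m})"
    by (rule suminf_emeasure) (auto simp: disjoint_family_on_def jump_count_event)
  also have "(\<Union>m. {w. jump_count w t = m}) = space noise_space" by auto
  finally show ?thesis by (simp add: count_prob_def N.emeasure_eq_measure[symmetric] N.emeasure_space_1[simplified])
qed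

lemma nn_integral_step_prob_stationary:
  assumes nonneg: "\<And>i. 0 \<le> \<sigma> i"
    and balance: "\<And>i. \<sigma> i = \<sigma> (i - 1) * p (i - 1) + \<sigma> (i + 1) * (1 - p (i + 1))"
  shows "(\<integral>\<^sup>+i. ennreal (\<sigma> i) * ennreal (step_prob p m i j) \<partial>count_space UNIV) = ennreal (\<sigma> j)"
proof (induction m)
  case 0
  have "(\<integral>\<^sup>+i. ennreal (\<sigma> i) * ennreal (step_prob p 0 i j) \<partial>count_space UNIV) =
      (\<integral>\<^sup>+i. ennreal (\<sigma> i) * indicator {j} i \<partial>count_space UNIV)"
    by (intro nn_integral_cong) (auto simp: indicator_def)
  then show ?case by simp
next
  case (Suc m)
  have bij: "bij (\<lambda>i::int. i + 1)" "bij (\<lambda>i::int. i - 1)"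
    by (rule bij_betw_byWitness[where f'="\<lambda>i. i - 1"] bij_betw_byWitness[where f'="\<lambda>i. i + 1"]; auto)+
  note pq = less_imp_le[OF p_pos] less_imp_le[OF p_less_1]
  have "(\<integral>\<^sup>+i. ennreal (\<sigma> i) * ennreal (step_prob p (Suc m) i j) \<partial>count_space UNIV) =
      (\<integral>\<^sup>+i. ennreal (\<sigma> i * p i) * ennreal (step_prob p m (i + 1) j) +
        ennreal (\<sigma> i * (1 - p i)) * ennreal (step_prob p m (i - 1) j) \<partial>count_space UNIV)"
  proof (intro nn_integral_cong)
    fix i
    have "\<sigma> i * step_prob p (Suc m) i j = \<sigma> i * p i * step_prob p m (i + 1) j + \<sigma> i * (1 - p i) * step_prob p m (i - 1) j"
      by (simp add: algebra_simps)
    then show "ennreal (\<sigma> i) * ennreal (step_prob p (Suc m) i j) =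
        ennreal (\<sigma> i * p i) * ennreal (step_prob p m (i + 1) j) +
        ennreal (\<sigma> i * (1 - p i)) * ennreal (step_prob p m (i - 1) j)"
      using nonneg pq step_prob_nonneg
      by (simp add: ennreal_mult[symmetric] ennreal_plus[symmetric] del: ennreal_plus step_prob.simps)
  qed
  also have "\<dots> = (\<integral>\<^sup>+i. ennreal (\<sigma> i * p i) * ennreal (step_prob p m (i + 1) j) \<partial>count_space UNIV) +
      (\<integral>\<^sup>+i. ennreal (\<sigma> i * (1 - p i)) * ennreal (step_prob p m (i - 1) j) \<partial>count_space UNIV)"
    by (rule nn_integral_add) auto
  also have "(\<integral>\<^sup>+i. ennreal (\<sigma> i * p i) * ennreal (step_prob p m (i + 1) j) \<partial>count_space UNIV) =
      (\<integral>\<^sup>+i. ennreal (\<sigma> (i - 1) * p (i - 1)) * ennreal (step_prob p m i j) \<partial>count_space UNIV)"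
    using nn_integral_bij_count_space[OF bij(1), of "\<lambda>i. ennreal (\<sigma> (i - 1) * p (i - 1)) * ennreal (step_prob p m i j)"]
    by simp
  also have "(\<integral>\<^sup>+i. ennreal (\<sigma> i * (1 - p i)) * ennreal (step_prob p m (i - 1) j) \<partial>count_space UNIV) =
      (\<integral>\<^sup>+i. ennreal (\<sigma> (i + 1) * (1 - p (i + 1))) * ennreal (step_prob p m i j) \<partial>count_space UNIV)"
    using nn_integral_bij_count_space[OF bij(2), of "\<lambda>i. ennreal (\<sigma> (i + 1) * (1 - p (i + 1))) * ennreal (step_prob p m i j)"]
    by simp
  also have "(\<integral>\<^sup>+i. ennreal (\<sigma> (i - 1) * p (i - 1)) * ennreal (step_prob p m i j) \<partial>count_space UNIV) +
      (\<integral>\<^sup>+i. ennreal (\<sigma> (i + 1) * (1 - p (i + 1))) * ennreal (step_prob p m i j) \<partial>count_space UNIV) =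
      (\<integral>\<^sup>+i. ennreal (\<sigma> (i - 1) * p (i - 1)) * ennreal (step_prob p m i j) +
        ennreal (\<sigma> (i + 1) * (1 - p (i + 1))) * ennreal (step_prob p m i j) \<partial>count_space UNIV)"
    by (rule nn_integral_add[symmetric]) auto
  also have "\<dots> = (\<integral>\<^sup>+i. ennreal (\<sigma> i) * ennreal (step_prob p m i j) \<partial>count_space UNIV)"
  proof (intro nn_integral_cong)
    fix i
    have "ennreal (\<sigma> i) = ennreal (\<sigma> (i - 1) * p (i - 1) + \<sigma> (i + 1) * (1 - p (i + 1)))"
      by (rule arg_cong[OF balance])
    also have "\<dots> = ennreal (\<sigma> (i - 1) * p (i - 1)) + ennreal (\<sigma> (i + 1) * (1 - p (i + 1)))"
      using nonneg pq by (intro ennreal_plus) auto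
    finally show "ennreal (\<sigma> (i - 1) * p (i - 1)) * ennreal (step_prob p m i j) +
        ennreal (\<sigma> (i + 1) * (1 - p (i + 1))) * ennreal (step_prob p m i j) =
        ennreal (\<sigma> i) * ennreal (step_prob p m i j)"
      by (simp only: distrib_right)
  qed
  finally show ?case unfolding Suc .
qed

lemma nn_integral_hop_prob_stationary:
  assumes "\<And>i. 0 \<le> \<sigma> i"
    and "\<And>i. \<sigma> i = \<sigma> (i - 1) * p (i - 1) + \<sigma> (i + 1) * (1 - p (i + 1))"
  shows "(\<integral>\<^sup>+i. ennreal (\<sigma> i) * ennreal (hop_prob t i j) \<partial>count_space UNIV) = ennreal (\<sigma> j)"
proof -
  have "(\<integral>\<^sup>+i. ennreal (\<sigma> i) * ennreal (hop_prob t i j) \<partial>count_space UNIV) =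
      (\<integral>\<^sup>+i. (\<Sum>m. ennreal (count_prob t m) * (ennreal (\<sigma> i) * ennreal (step_prob p m i j))) \<partial>count_space UNIV)"
    unfolding ennreal_hop_prob
    by (intro nn_integral_cong, subst ennreal_suminf_cmult[symmetric]) (simp only: mult.left_commute)
  also have "\<dots> = (\<Sum>m. ennreal (count_prob t m) * (\<integral>\<^sup>+i. ennreal (\<sigma> i) * ennreal (step_prob p m i j) \<partial>count_space UNIV))"
    by (subst nn_integral_suminf) (auto simp: nn_integral_cmult)
  also have "\<dots> = (\<Sum>m. ennreal (count_prob t m)) * ennreal (\<sigma> j)"
    by (simp add: nn_integral_step_prob_stationary[OF assms(1) assms(2)])
  also have "\<dots> = ennreal (\<sigma> j)" by (simp add: suminf_count_prob)
  finally show ?thesis .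
qed

end

text \<open>The product of the ratios \<open>(1 - p) / p\<close> over the \<open>n\<close> sites to the right of \<open>j\<close>.\<close>
definition odds_prod :: "(int \<Rightarrow> real) \<Rightarrow> int \<Rightarrow> nat \<Rightarrow> real" where
  "odds_prod p j n = (\<Prod>k<n. (1 - p (j + 1 + int k)) / p (j + 1 + int k))"

context environment
begin

lemma odds_prod_pos: "0 < odds_prod p j n"
  unfolding odds_prod_def using p_pos p_less_1 by (intro prod_pos) auto

lemma odds_prod_Suc: "p (j + 1 + int n) * odds_prod p j (Suc n) = (1 - p (j + 1 + int n)) * odds_prod p j n"
  using p_pos[of "j + 1 + int n"] by (simp add: odds_prod_def)

text \<open>
  Transience.  The function \<open>g\<close> below is constant to the left of \<open>j\<close> and equal to the tail of the series of
  \<open>odds_prod p j\<close> to the right of it.  It is harmonic except at \<open>j\<close>, where it exceeds its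
  average over the next position by \<open>p j\<close>.  Consequently the expected number of visits to \<open>j\<close>
  from \<open>i\<close> is at most \<open>g i / p j\<close>.
\<close>
lemma step_prob_tendsto_0:
  assumes summable: "summable (odds_prod p j)"
  shows "(\<lambda>n. step_prob p n i j) \<longlonglongrightarrow> 0"
proof -
  define g where "g i = (\<Sum>n. odds_prod p j (n + nat (i - j)))" for i
  have sm: "summable (\<lambda>n. odds_prod p j (n + m))" for m
    using summable by (simp add: summable_iff_shift)
  have g_nonneg: "0 \<le> g i" for i
    unfolding g_def using less_imp_le[OF odds_prod_pos] by (intro suminf_nonneg sm) auto
  have g_step: "g i = odds_prod p j (nat (i - j)) + g (i + 1)" if "j \<le> i" for i
  proof -
    have "nat (i + 1 - j) = Suc (nat (i - j))" using that by auto
    then show ?thesis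
      unfolding g_def using suminf_split_head[OF sm[of "nat (i - j)"]] by simp
  qed
  have g_const: "g i = g j" if "i \<le> j" for i
    using that by (simp add: g_def)
  have super: "of_bool (i = j) * p j + p i * g (i + 1) + (1 - p i) * g (i - 1) = g i" for i
  proof -
    consider "i < j" | "i = j" | "j < i" by linarith
    then show ?thesis
    proof cases
      case 1
      then show ?thesis
        using g_const[of i] g_const[of "i + 1"] g_const[of "i - 1"] by (simp add: algebra_simps)
    next
      case 2
      then show ?thesis
        using g_const[of "i - 1"] g_step[of i] by (simp add: algebra_simps odds_prod_def)
    next
      case 3
      define m where "m = nat (i - 1 - j)"
      have m: "nat (i - j) = Suc m" "j + 1 + int m = i" using 3 by (auto simp: m_def)
      have 1: "g (i - 1) = odds_prod p j m + g i" using g_step[of "i - 1"] 3 by (simp add: m_def)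
      have 2: "g i = odds_prod p j (Suc m) + g (i + 1)" using g_step[of i] 3 m by simp
      have "p i * odds_prod p j (Suc m) = (1 - p i) * odds_prod p j m"
        using odds_prod_Suc[of j m] m by simp
      then have "p i * (g i - g (i + 1)) = (1 - p i) * (g (i - 1) - g i)" using 1 2 by simp
      with 3 show ?thesis by (simp add: algebra_simps)
    qed
  qed
  have bound: "(\<Sum>n<N. step_prob p n i j) * p j \<le> g i" for N
  proof (induction N arbitrary: i)
    case 0
    then show ?case using g_nonneg by simp
  next
    case (Suc N)
    have "(\<Sum>n<Suc N. step_prob p n i j) * p j =
        of_bool (i = j) * p j + p i * ((\<Sum>n<N. step_prob p n (i + 1) j) * p j) +
        (1 - p i) * ((\<Sum>n<N. step_prob p n (i - 1) j) * p j)"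
      by (simp only: sum.lessThan_Suc_shift step_prob.simps sum.distrib sum_distrib_left[symmetric])
        (simp add: algebra_simps)
    also have "\<dots> \<le> of_bool (i = j) * p j + p i * g (i + 1) + (1 - p i) * g (i - 1)"
      using Suc p_pos[of i] p_less_1[of i] by (intro add_mono mult_left_mono) auto
    also have "\<dots> = g i" by (rule super)
    finally show ?case .
  qed
  have "summable (\<lambda>n. step_prob p n i j)"
  proof (rule bounded_imp_summable[where B="g i / p j"])
    show "(\<Sum>n\<le>N. step_prob p n i j) \<le> g i / p j" for N
      using bound[of "Suc N"] p_pos[of j] by (simp add: field_simps lessThan_Suc_atMost)
  qed (rule step_prob_nonneg)
  then show ?thesis by (rule summable_LIMSEQ_zero)
qed

end

text \<open>If all holding times were at most \<open>c\<close>, this would hold for the first one and for the others;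
  hence the probability \<open>x\<close> of this event satisfies \<open>x = (1 - exp (- c)) * x\<close>.\<close>
lemma AE_holding_times_unbounded: "AE w in noise_space. \<exists>k. real c < fst (w k)"
proof -
  interpret N: prob_space noise_space by (rule prob_space_noise_space)
  interpret U: prob_space "uniform_measure lborel {0..1::real}" by (rule prob_space_direction)
  let ?E = "density lborel (exponential_density 1)"
  define B where "B = {w :: nat \<Rightarrow> real \<times> real. \<forall>k. fst (w k) \<le> real c}"
  have B: "B \<in> sets noise_space"
  proof -
    have "{w \<in> space noise_space. \<forall>k. fst (w k) \<le> real c} \<in> sets noise_space" by measurable
    then show ?thesis by (simp add: B_def)
  qed
  have B_case: "case_nat x w \<in> B \<longleftrightarrow> fst x \<le> real c \<and> w \<in> B" for x :: "real \<times> real" and w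
    unfolding B_def mem_Collect_eq by (metis not0_implies_Suc old.nat.simps(4) old.nat.simps(5))
  have "emeasure noise_space B = (\<integral>\<^sup>+x. \<integral>\<^sup>+w. indicator B (case_nat x w) \<partial>noise_space \<partial>jump_noise)"
    using B by (subst nn_integral_noise_space_shift[symmetric]) auto
  also have "\<dots> = (\<integral>\<^sup>+x. indicator ({..real c} \<times> UNIV) x * emeasure noise_space B \<partial>jump_noise)"
  proof (intro nn_integral_cong)
    fix x :: "real \<times> real"
    have "(\<integral>\<^sup>+w. indicator B (case_nat x w) \<partial>noise_space) =
        (\<integral>\<^sup>+w. indicator ({..real c} \<times> UNIV) x * indicator B w \<partial>noise_space)"
      by (intro nn_integral_cong) (auto simp: indicator_def B_case mem_Times_iff)
    also have "\<dots> = indicator ({..real c} \<times> UNIV) x * emeasure noise_space B"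
      using B by (simp add: nn_integral_cmult)
    finally show "(\<integral>\<^sup>+w. indicator B (case_nat x w) \<partial>noise_space) =
        indicator ({..real c} \<times> UNIV) x * emeasure noise_space B" .
  qed
  also have "\<dots> = emeasure jump_noise ({..real c} \<times> UNIV) * emeasure noise_space B"
    by (subst nn_integral_multc) auto
  also have "emeasure jump_noise ({..real c} \<times> UNIV) = emeasure ?E {..real c}"
    using U.emeasure_space_1 by (subst U.emeasure_pair_measure_Times) auto
  also have "emeasure ?E {..real c} = ennreal (1 - exp (- real c))"
    using emeasure_erlang_density[of 1 0 "real c"] by (simp add: erlang_CDF_0)
  finally have "measure noise_space B = (1 - exp (- real c)) * measure noise_space B"
    by (simp add: N.emeasure_eq_measure ennreal_mult[symmetric])
  then have "measure noise_space B = 0" by (simp add: algebra_simps)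
  then have "B \<in> null_sets noise_space" using B by (simp add: null_sets_def N.emeasure_eq_measure)
  then have "AE w in noise_space. w \<notin> B" by (rule AE_not_in)
  then show ?thesis by eventually_elim (auto simp: B_def not_le)
qed

lemma AE_holding_times_nonneg: "AE w in noise_space. \<forall>k. 0 \<le> fst (w k)"
proof -
  interpret U: prob_space "uniform_measure lborel {0..1::real}" by (rule prob_space_direction)
  have "AE a in density lborel (exponential_density 1). 0 \<le> a"
    by (subst AE_density) (auto simp: exponential_density_def)
  then have "AE a in distr jump_noise (density lborel (exponential_density 1)) fst. 0 \<le> a"
    by (subst U.distr_pair_fst)
  then have "AE x in jump_noise. 0 \<le> fst x" by (rule AE_distrD[OF measurable_fst])
  then have "AE w in noise_space. 0 \<le> fst (w k)" for k
    unfolding noise_space_def by (rule AE_PiM_component[OF prob_space_jump_noise, rotated]) auto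
  then show ?thesis by (simp add: AE_all_countable)
qed

text \<open>The unbounded holding times also exclude that \<open>jump_count\<close> is 0 because infinitely many jumps
  have occurred.\<close>
lemma AE_jump_count_eventually_neq:
  "AE w in noise_space. \<forall>\<^sub>F n in sequentially. jump_count w (real n) \<noteq> m"
proof -
  have "AE w in noise_space. \<forall>c::nat. \<exists>k. real c < fst (w k)"
    unfolding AE_all_countable using AE_holding_times_unbounded by simp
  with AE_holding_times_nonneg show ?thesis
  proof eventually_elim
    case (elim w)
    have mono: "(\<Sum>k\<le>a. fst (w k)) \<le> (\<Sum>k\<le>b. fst (w k))" if "a \<le> b" for a b
      using that elim by (intro sum_mono2) auto
    obtain n0 :: nat where n0: "(\<Sum>k\<le>m. fst (w k)) \<le> real n0" using real_arch_simple by blast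
    have "jump_count w (real n) \<noteq> m" if "n0 \<le> n" for n
    proof -
      let ?S = "{i. (\<Sum>k\<le>i. fst (w k)) \<le> real n}"
      obtain k where k: "real n < fst (w k)" using elim by blast
      have "i < k" if "i \<in> ?S" for i
      proof (rule ccontr)
        assume "\<not> i < k"
        then have "fst (w k) \<le> (\<Sum>k\<le>i. fst (w k))" using elim by (intro member_le_sum) auto
        with that k show False by simp
      qed
      then have "finite ?S" by (intro finite_subset[OF _ finite_lessThan[of k]]) auto
      moreover have "{..m} \<subseteq> ?S"
      proof
        fix i assume "i \<in> {..m}"
        then show "i \<in> ?S" using mono[of i m] n0 that by simp
      qed
      ultimately have "card {..m} \<le> card ?S" by (intro card_mono)
      then show ?thesis by (simp add: jump_count_def)
    qed
    then show ?case by (auto simp: eventually_sequentially)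
  qed
qed

lemma (in environment) count_prob_tendsto_0: "(\<lambda>n. count_prob (real n) m) \<longlonglongrightarrow> 0"
proof -
  interpret N: prob_space noise_space by (rule prob_space_noise_space)
  have "(\<lambda>n. \<integral>w. indicator {w. jump_count w (real n) = m} w \<partial>noise_space) \<longlonglongrightarrow> (\<integral>w. (0::real) \<partial>noise_space)"
  proof (rule integral_dominated_convergence[where w="\<lambda>_. 1"])
    show "AE w in noise_space. (\<lambda>n. indicator {w. jump_count w (real n) = m} w) \<longlonglongrightarrow> (0::real)"
      using AE_jump_count_eventually_neq[of m]
    proof eventually_elim
      case (elim w)
      show ?case
        by (rule tendsto_eventually, rule eventually_mono[OF elim]) (simp add: indicator_def)
    qed
  qed (auto simp: jump_count_event)
  then show ?thesis by (simp add: count_prob_def jump_count_event)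
qed

lemma (in environment) hop_prob_tendsto_0:
  assumes step: "(\<lambda>n. step_prob p n i j) \<longlonglongrightarrow> 0"
  shows "(\<lambda>n. hop_prob (real n) i j) \<longlonglongrightarrow> 0"
proof (rule LIMSEQ_I)
  fix r :: real assume r: "0 < r"
  obtain K where K: "\<And>m. m \<ge> K \<Longrightarrow> step_prob p m i j < r / 3"
  proof -
    obtain K where "\<forall>m\<ge>K. norm (step_prob p m i j - 0) < r / 3"
      using LIMSEQ_D[OF step, of "r / 3"] r by auto
    then show thesis using step_prob_nonneg[of _ i j] by (intro that[of K]) auto
  qed
  have step_le: "step_prob p m i j \<le> 1" for m i
  proof (induction m arbitrary: i)
    case (Suc m)
    have "step_prob p (Suc m) i j \<le> p i * 1 + (1 - p i) * 1"
      unfolding step_prob.simps using p_pos[of i] p_less_1[of i] Suc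
      by (intro add_mono mult_left_mono) auto
    then show ?case by simp
  qed simp
  have c_nonneg: "0 \<le> count_prob t m" for t m by (simp add: count_prob_def)
  have bound: "hop_prob t i j \<le> (\<Sum>m<K. count_prob t m) + r / 3" for t
  proof -
    have "ennreal (hop_prob t i j) \<le> (\<Sum>m. ennreal (if m < K then count_prob t m else 0) + ennreal (count_prob t m) * ennreal (r / 3))"
      unfolding ennreal_hop_prob
    proof (intro suminf_le summableI)
      fix m
      show "ennreal (count_prob t m) * ennreal (step_prob p m i j) \<le>
          ennreal (if m < K then count_prob t m else 0) + ennreal (count_prob t m) * ennreal (r / 3)"
      proof (cases "m < K")
        case True
        have "ennreal (count_prob t m) * ennreal (step_prob p m i j) \<le> ennreal (count_prob t m) * 1"
          using step_le[of m i] by (intro mult_left_mono) auto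
        also have "\<dots> \<le> ennreal (count_prob t m) + ennreal (count_prob t m) * ennreal (r / 3)" by simp
        finally show ?thesis using True by simp
      next
        case False
        then show ?thesis using K[of m] by (auto intro!: mult_left_mono ennreal_leI)
      qed
    qed
    also have "\<dots> = (\<Sum>m. ennreal (if m < K then count_prob t m else 0)) + (\<Sum>m. ennreal (count_prob t m)) * ennreal (r / 3)"
      by (simp add: suminf_add[symmetric])
    also have "(\<Sum>m. ennreal (if m < K then count_prob t m else 0)) = (\<Sum>m<K. ennreal (count_prob t m))"
      by (subst suminf_finite[of "{..<K}"]) auto
    also have "\<dots> = ennreal (\<Sum>m<K. count_prob t m)" by (simp add: c_nonneg)
    finally have "ennreal (hop_prob t i j) \<le> ennreal ((\<Sum>m<K. count_prob t m) + r / 3)"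
      using r c_nonneg by (simp add: suminf_count_prob ennreal_plus[symmetric] sum_nonneg del: ennreal_plus)
    then show ?thesis using r c_nonneg by (subst (asm) ennreal_le_iff) (auto intro!: add_nonneg_nonneg sum_nonneg)
  qed
  have "(\<lambda>n. \<Sum>m<K. count_prob (real n) m) \<longlonglongrightarrow> (\<Sum>m<K. 0)"
    by (intro tendsto_sum count_prob_tendsto_0)
  then obtain n0 where n0: "\<And>n. n \<ge> n0 \<Longrightarrow> \<bar>\<Sum>m<K. count_prob (real n) m\<bar> < r / 3"
    using LIMSEQ_D[of _ 0 "r / 3"] r by fastforce
  show "\<exists>no. \<forall>n\<ge>no. norm (hop_prob (real n) i j - 0) < r"
  proof (intro exI allI impI)
    fix n assume "n0 \<le> n"
    with n0[of n] bound[of "real n"] r show "norm (hop_prob (real n) i j - 0) < r"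
      by (simp add: hop_prob_def)
  qed
qed

section \<open>Generating functionals determine the law of a configuration\<close>

text \<open>The weights are recovered one after the other: once those below \<open>m\<close> are known, the weight of \<open>m\<close>
  is the limit of \<open>(\<integral>n. s ^ n \<partial>N) / s ^ m\<close>, with the known terms subtracted, as \<open>s\<close> tends to 0.\<close>
lemma measure_nat_eqI_generating_function:
  fixes N1 N2 :: "nat measure"
  assumes "finite_measure N1" "finite_measure N2"
    and sets1: "sets N1 = UNIV" and sets2: "sets N2 = UNIV"
    and eq: "\<And>s::real. 0 \<le> s \<Longrightarrow> s \<le> 1 \<Longrightarrow> (\<integral>n. s ^ n \<partial>N1) = (\<integral>n. s ^ n \<partial>N2)"
  shows "N1 = N2"
proof -
  interpret N1: finite_measure N1 by fact
  interpret N2: finite_measure N2 by fact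
  have point: "measure N1 {m} = measure N2 {m}" for m
  proof (induction m rule: less_induct)
    case (less m)
    define s where "s k = inverse (real (Suc (Suc k)))" for k
    have s: "0 < s k" "s k < 1" for k by (auto simp: s_def field_simps)
    have s_lim: "s \<longlonglongrightarrow> 0"
      unfolding s_def[abs_def] using LIMSEQ_Suc[OF LIMSEQ_inverse_real_of_nat] .
    define h where "h k n = indicator {m..} n * s k ^ (n - m)" for k n
    have h_bound: "\<bar>h k n\<bar> \<le> 1" for k n
      using s[of k] by (auto simp: h_def indicator_def power_le_one)
    have expand: "(\<integral>n. s k ^ n \<partial>N) = (\<Sum>j<m. s k ^ j * measure N {j}) + s k ^ m * (\<integral>n. h k n \<partial>N)"
      and lim: "(\<lambda>k. \<integral>n. h k n \<partial>N) \<longlonglongrightarrow> measure N {m}"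
      if fm: "finite_measure N" and sts: "sets N = UNIV" for N and k
    proof -
      interpret finite_measure N by fact
      note sts [measurable_cong]
      have sp: "space N = UNIV" using sets_eq_imp_space_eq[of N "count_space UNIV"] sts by simp
      have meas: "f \<in> borel_measurable N" for f :: "nat \<Rightarrow> real"
        by (simp add: measurable_def sp sts)
      have bnd: "integrable N f" if "\<And>n. \<bar>f n\<bar> \<le> 1" for f :: "nat \<Rightarrow> real"
        by (rule integrable_const_bound[where B=1]) (use that meas in auto)
      have "s k ^ n = (\<Sum>j<m. s k ^ j * indicator {j} n) + s k ^ m * h k n" for n
      proof (cases "n < m")
        case True
        have "(\<Sum>j<m. s k ^ j * indicator {j} n) = (\<Sum>j\<in>{n}. s k ^ j * indicator {j} n)"
          by (rule sum.mono_neutral_right) (use True in \<open>auto simp: indicator_def\<close>)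
        with True show ?thesis by (simp add: h_def)
      next
        case False
        then have "(\<Sum>j<m. s k ^ j * indicator {j} n) = 0"
          by (intro sum.neutral) (auto simp: indicator_def)
        with False show ?thesis by (simp add: h_def power_add[symmetric])
      qed
      then have "(\<integral>n. s k ^ n \<partial>N) = (\<integral>n. (\<Sum>j<m. s k ^ j * indicator {j} n) + s k ^ m * h k n \<partial>N)"
        by (rule Bochner_Integration.integral_cong[OF refl])
      also have "\<dots> = (\<Sum>j<m. s k ^ j * measure N {j}) + s k ^ m * (\<integral>n. h k n \<partial>N)"
      proof -
        define d where "d j n = (indicator {j} n :: real)" for j n :: nat
        have "integrable N (\<lambda>n. h k n)" "\<And>j. integrable N (\<lambda>n. d j n)"
          using h_bound by (auto intro!: bnd simp: d_def indicator_def)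
        then have "(\<integral>n. (\<Sum>j<m. s k ^ j * d j n) + s k ^ m * h k n \<partial>N) =
            (\<Sum>j<m. s k ^ j * (\<integral>n. d j n \<partial>N)) + s k ^ m * (\<integral>n. h k n \<partial>N)"
          by (simp add: Bochner_Integration.integral_add Bochner_Integration.integral_sum)
        moreover have "(\<integral>n. d j n \<partial>N) = measure N {j}" for j
          by (simp add: d_def sts)
        ultimately show ?thesis by (simp only: d_def)
      qed
      finally show "(\<integral>n. s k ^ n \<partial>N) = (\<Sum>j<m. s k ^ j * measure N {j}) + s k ^ m * (\<integral>n. h k n \<partial>N)" .
      have "(\<lambda>k. \<integral>n. h k n \<partial>N) \<longlonglongrightarrow> (\<integral>n. indicator {m} n \<partial>N)"
      proof (rule integral_dominated_convergence[where w="\<lambda>_. 1"])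
        show "AE n in N. (\<lambda>k. h k n) \<longlonglongrightarrow> indicator {m} n"
        proof (rule AE_I2)
          fix n
          consider "n < m" | "n = m" | "n > m" by linarith
          then show "(\<lambda>k. h k n) \<longlonglongrightarrow> indicator {m} n"
          proof cases
            case 3
            then have "(\<lambda>k. s k ^ (n - m)) \<longlonglongrightarrow> 0"
              using tendsto_power[OF s_lim, of "n - m"] by (simp add: power_0_left)
            with 3 show ?thesis by (simp add: h_def)
          qed (simp_all add: h_def)
        qed
      qed (use h_bound meas in auto)
      then show "(\<lambda>k. \<integral>n. h k n \<partial>N) \<longlonglongrightarrow> measure N {m}" by (simp add: sts)
    qed
    have "(\<integral>n. h k n \<partial>N1) = (\<integral>n. h k n \<partial>N2)" for k
      using expand[OF assms(1) sets1, of k] expand[OF assms(2) sets2, of k] eq[of "s k"] s[of k] less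
      by simp
    then show ?case
      using lim[OF assms(1) sets1] lim[OF assms(2) sets2] LIMSEQ_unique by auto
  qed
  show ?thesis
  proof (rule measure_eqI_countable[where A=UNIV])
    show "emeasure N1 {a} = emeasure N2 {a}" for a
      using point[of a] by (simp add: N1.emeasure_eq_measure N2.emeasure_eq_measure)
  qed (use sets1 sets2 in auto)
qed

lemma space_config_space: "sets N = sets config_space \<Longrightarrow> space N = UNIV"
  using sets_eq_imp_space_eq[of N config_space] by (simp add: space_PiM)

text \<open>The coordinates are treated one at a time: \<open>mixed\<close> replaces the powers \<open>s i ^ \<eta> i\<close> by indicators
  of events \<open>\<eta> i \<in> A i\<close>, for \<open>i\<close> in the growing set \<open>I\<close>.\<close>
lemma config_measure_eqI:
  assumes "finite_measure N1" "finite_measure N2"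
    and sets1: "sets N1 = sets config_space" and sets2: "sets N2 = sets config_space"
    and eq: "\<And>J s. finite J \<Longrightarrow> (\<And>j. 0 \<le> s j \<and> s j \<le> 1) \<Longrightarrow>
      (\<integral>\<eta>. (\<Prod>j\<in>J. (s j :: real) ^ \<eta> j) \<partial>N1) = (\<integral>\<eta>. (\<Prod>j\<in>J. s j ^ \<eta> j) \<partial>N2)"
  shows "N1 = N2"
proof -
  interpret N1: finite_measure N1 by fact
  interpret N2: finite_measure N2 by fact
  note sets1 [measurable_cong] sets2 [measurable_cong]
  have mixed: "(\<integral>\<eta>. (\<Prod>i\<in>I. indicator (A i) (\<eta> i)) * (\<Prod>j\<in>J. s j ^ \<eta> j) \<partial>N1) =
      (\<integral>\<eta>. (\<Prod>i\<in>I. indicator (A i) (\<eta> i)) * (\<Prod>j\<in>J. s j ^ \<eta> j) \<partial>N2)"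
    if "finite I" "finite J" "I \<inter> J = {}" "\<And>j. 0 \<le> s j \<and> s j \<le> 1"
    for I J :: "int set" and A :: "int \<Rightarrow> nat set" and s :: "int \<Rightarrow> real"
    using that
  proof (induction I arbitrary: J s rule: finite_induct)
    case empty
    then show ?case using eq[of J s] by simp
  next
    case (insert x I)
    define R where "R \<eta> = (\<Prod>i\<in>I. indicator (A i) (\<eta> i)) * (\<Prod>j\<in>J. s j ^ \<eta> j)" for \<eta> :: "int \<Rightarrow> nat"
    have R01: "0 \<le> R \<eta>" "R \<eta> \<le> 1" for \<eta>
      using insert.prems by (auto simp: R_def intro!: mult_nonneg_nonneg prod_nonneg mult_le_one prod_le_1 power_le_one)
    have [measurable]: "R \<in> borel_measurable config_space"
      unfolding R_def by measurable
    define D where "D N = distr (density N R) (count_space UNIV) (\<lambda>\<eta>. \<eta> x)" for N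
    have sets_D: "sets (D N) = UNIV" for N by (simp add: D_def)
    have fin: "finite_measure (D N)"
      and int: "(\<integral>n. f n \<partial>D N) = (\<integral>\<eta>. R \<eta> * f (\<eta> x) \<partial>N)"
      if "finite_measure N" and sets: "sets N = sets config_space" for N and f :: "nat \<Rightarrow> real"
    proof -
      interpret finite_measure N by fact
      note sets [measurable_cong]
      have "finite_measure (density N R)"
      proof
        have "emeasure (density N R) (space (density N R)) = (\<integral>\<^sup>+\<eta>. R \<eta> \<partial>N)"
          by (simp add: emeasure_density cong: nn_integral_cong)
        also have "\<dots> \<le> (\<integral>\<^sup>+\<eta>. 1 \<partial>N)"
          using R01 by (intro nn_integral_mono) auto
        also have "\<dots> < \<infinity>" using emeasure_finite[of "space N"] by (simp add: less_top[symmetric])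
        finally show "emeasure (density N R) (space (density N R)) \<noteq> \<infinity>" by simp
      qed
      then show "finite_measure (D N)"
        unfolding D_def by (rule finite_measure.finite_measure_distr) simp
      show "(\<integral>n. f n \<partial>D N) = (\<integral>\<eta>. R \<eta> * f (\<eta> x) \<partial>N)"
        unfolding D_def using R01 by (subst integral_distr) (auto simp: integral_density)
    qed
    have "D N1 = D N2"
    proof (rule measure_nat_eqI_generating_function)
      fix t :: real assume t: "0 \<le> t" "t \<le> 1"
      have x: "x \<notin> J" "x \<notin> I" using insert by auto
      have *: "R \<eta> * t ^ \<eta> x = (\<Prod>i\<in>I. indicator (A i) (\<eta> i)) * (\<Prod>j\<in>insert x J. (s(x := t)) j ^ \<eta> j)" for \<eta>
      proof -
        have "(\<Prod>j\<in>J. (s(x := t)) j ^ \<eta> j) = (\<Prod>j\<in>J. s j ^ \<eta> j)"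
          using x by (intro prod.cong) auto
        then show ?thesis using x insert.prems by (simp add: R_def)
      qed
      show "(\<integral>n. t ^ n \<partial>D N1) = (\<integral>n. t ^ n \<partial>D N2)"
        unfolding int[OF assms(1) sets1] int[OF assms(2) sets2] *
        using insert.prems insert.hyps t by (intro insert.IH) auto
    qed (use fin[OF assms(1) sets1] fin[OF assms(2) sets2] sets_D in simp_all)
    then have "(\<integral>n. indicator (A x) n \<partial>D N1) = (\<integral>n. indicator (A x) n \<partial>D N2 :: real)" by simp
    then show ?case
      unfolding int[OF assms(1) sets1] int[OF assms(2) sets2]
      using insert.hyps by (simp add: R_def mult_ac)
  qed
  show ?thesis
  proof (rule measure_eqI_PiM_infinite[OF sets1 sets2])
    fix A :: "int \<Rightarrow> nat set" and J :: "int set"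
    assume J: "finite J" "J \<subseteq> UNIV"
    let ?E = "prod_emb UNIV (\<lambda>_. count_space UNIV) J (Pi\<^sub>E J A)"
    have E: "?E \<in> sets config_space" using J by (intro sets_PiM_I_finite sets_PiM_I) auto
    have ind: "indicator ?E \<eta> = (\<Prod>i\<in>J. indicator (A i) (\<eta> i) :: real) * (\<Prod>j\<in>{}. 1 ^ \<eta> j)" for \<eta> :: "int \<Rightarrow> nat"
      using J by (auto simp: indicator_def prod_emb_def space_PiM Pi_iff intro!: prod.neutral)
    have "measure N ?E = (\<integral>\<eta>. (\<Prod>i\<in>J. indicator (A i) (\<eta> i)) * (\<Prod>j\<in>{}. 1 ^ \<eta> j) \<partial>N)"
      if "sets N = sets config_space" for N
      unfolding ind[symmetric] using E that by simp
    then have "measure N1 ?E = measure N2 ?E"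
      using mixed[of J "{}" "\<lambda>_. 1" A] J sets1 sets2 by simp
    then show "emeasure N1 ?E = emeasure N2 ?E"
      by (simp add: N1.emeasure_eq_measure N2.emeasure_eq_measure)
  qed (use assms in auto)
qed

section \<open>Product Poisson fields\<close>

lemma integral_PiM_prod:
  fixes f :: "'i \<Rightarrow> 'b \<Rightarrow> real"
  assumes prob: "\<And>i. prob_space (N i)" and fin: "finite J"
    and int: "\<And>i. i \<in> J \<Longrightarrow> integrable (N i) (f i)"
  shows "(\<integral>x. (\<Prod>i\<in>J. f i (x i)) \<partial>PiM UNIV N) = (\<Prod>i\<in>J. \<integral>y. f i y \<partial>N i)"
proof -
  interpret prob_space "N i" for i by (rule prob)
  interpret product_prob_space N UNIV by unfold_locales
  have [measurable]: "f i \<in> borel_measurable (N i)" if "i \<in> J" for i using int[OF that] by auto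
  have "(\<integral>x. (\<Prod>i\<in>J. f i (x i)) \<partial>PiM UNIV N) = (\<integral>x. (\<Prod>i\<in>J. f i (restrict x J i)) \<partial>PiM UNIV N)"
    by simp
  also have "\<dots> = (\<integral>x. (\<Prod>i\<in>J. f i (x i)) \<partial>distr (PiM UNIV N) (PiM J N) (\<lambda>x. restrict x J))"
  proof (rule integral_distr[symmetric])
    show "(\<lambda>x. restrict x J) \<in> PiM UNIV N \<rightarrow>\<^sub>M PiM J N" by (rule measurable_restrict_subset) simp
  qed measurable
  also have "distr (PiM UNIV N) (PiM J N) (\<lambda>x. restrict x J) = PiM J N"
    by (rule distr_PiM_restrict_finite) (use fin in auto)
  also have "(\<integral>x. (\<Prod>i\<in>J. f i (x i)) \<partial>PiM J N) = (\<Prod>i\<in>J. \<integral>y. f i y \<partial>N i)"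
    by (rule product_integral_prod[OF fin int])
  finally show ?thesis .
qed

lemma nn_integral_poisson_pmf:
  assumes r: "0 < r" and f: "\<And>n. 0 \<le> f n" and sums: "(\<lambda>n. r ^ n / fact n * exp (- r) * f n) sums c"
  shows "(\<integral>\<^sup>+n. ennreal (f n) \<partial>measure_pmf (poisson_pmf r)) = ennreal c"
proof -
  have "(\<integral>\<^sup>+n. ennreal (f n) \<partial>measure_pmf (poisson_pmf r)) =
      (\<integral>\<^sup>+n. ennreal (r ^ n / fact n * exp (- r) * f n) \<partial>count_space UNIV)"
    unfolding nn_integral_measure_pmf using r f
    by (intro nn_integral_cong) (simp add: ennreal_mult'[symmetric])
  also have "\<dots> = (\<Sum>n. ennreal (r ^ n / fact n * exp (- r) * f n))"
    by (rule nn_integral_count_space_nat)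
  also have "\<dots> = ennreal c"
    by (rule suminf_ennreal_eq[OF _ sums]) (use r f in auto)
  finally show ?thesis .
qed

lemma integral_poisson_pmf_power:
  assumes r: "0 < r" and s: "0 \<le> s"
  shows "(\<integral>n. s ^ n \<partial>measure_pmf (poisson_pmf r)) = exp (- r * (1 - s))"
proof (rule integral_eq_nn_integral[THEN trans])
  have "(\<lambda>n. exp (- r) * ((r * s) ^ n /\<^sub>R fact n)) sums (exp (- r) * exp (r * s))"
    by (intro sums_mult exp_converges)
  then have "(\<lambda>n. r ^ n / fact n * exp (- r) * s ^ n) sums (exp (- r * (1 - s)))"
    by (simp add: power_mult_distrib field_simps exp_add[symmetric] scaleR_conv_of_real)
  from nn_integral_poisson_pmf[OF r _ this] s
  show "enn2real (\<integral>\<^sup>+n. ennreal (s ^ n) \<partial>measure_pmf (poisson_pmf r)) = exp (- r * (1 - s))"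
    by simp
qed (use s in auto)

lemma nn_integral_poisson_pmf_mean:
  assumes r: "0 < r"
  shows "(\<integral>\<^sup>+n. ennreal (real n) \<partial>measure_pmf (poisson_pmf r)) = ennreal r"
proof (rule nn_integral_poisson_pmf[OF r])
  have "(\<lambda>n. r * exp (- r) * (r ^ n /\<^sub>R fact n)) sums (r * exp (- r) * exp r)"
    by (intro sums_mult exp_converges)
  also have "r * exp (- r) * exp r = r" by (simp add: exp_minus)
  also have "(\<lambda>n. r * exp (- r) * (r ^ n /\<^sub>R fact n)) =
      (\<lambda>n. r ^ Suc n / fact (Suc n) * exp (- r) * real (Suc n))"
  proof
    fix n
    have "real (Suc n) \<noteq> 0" by simp
    then show "r * exp (- r) * (r ^ n /\<^sub>R fact n) = r ^ Suc n / fact (Suc n) * exp (- r) * real (Suc n)"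
      by (simp add: divide_simps del: of_nat_Suc)
  qed
  finally have "(\<lambda>n. r ^ Suc n / fact (Suc n) * exp (- r) * real (Suc n)) sums r" .
  from sums_Suc[OF this] show "(\<lambda>n. r ^ n / fact n * exp (- r) * real n) sums r" by simp
qed simp

text \<open>The law of a configuration with independent Poisson numbers of particles, of mean \<open>\<sigma> i\<close> at \<open>i\<close>.\<close>
definition poisson_field :: "(int \<Rightarrow> real) \<Rightarrow> (int \<Rightarrow> nat) measure" where
  "poisson_field \<sigma> = (\<Pi>\<^sub>M i\<in>UNIV. measure_pmf (poisson_pmf (\<sigma> i)))"

lemma prob_space_poisson_field: "prob_space (poisson_field \<sigma>)"
  unfolding poisson_field_def by (intro prob_space_PiM prob_space_measure_pmf)

lemma sets_poisson_field [measurable_cong]: "sets (poisson_field \<sigma>) = sets config_space"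
  unfolding poisson_field_def by (intro sets_PiM_cong) auto

lemma integral_poisson_field_prod:
  assumes "finite J" "\<And>i n. i \<in> J \<Longrightarrow> \<bar>f i n\<bar> \<le> (1::real)"
  shows "(\<integral>\<eta>. (\<Prod>i\<in>J. f i (\<eta> i)) \<partial>poisson_field \<sigma>) =
    (\<Prod>i\<in>J. \<integral>n. f i n \<partial>measure_pmf (poisson_pmf (\<sigma> i)))"
  unfolding poisson_field_def using assms
  by (intro integral_PiM_prod prob_space_measure_pmf measure_pmf.integrable_const_bound[where B=1]) auto

lemma integral_poisson_field_power:
  assumes "finite J" "\<And>i. 0 < \<sigma> i" "\<And>i. 0 \<le> v i \<and> v i \<le> 1"
  shows "(\<integral>\<eta>. (\<Prod>i\<in>J. v i ^ \<eta> i) \<partial>poisson_field \<sigma>) = exp (- (\<Sum>i\<in>J. \<sigma> i * (1 - v i)))"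
proof -
  have "(\<integral>\<eta>. (\<Prod>i\<in>J. v i ^ \<eta> i) \<partial>poisson_field \<sigma>) = (\<Prod>i\<in>J. exp (- \<sigma> i * (1 - v i)))"
    using assms by (subst integral_poisson_field_prod) (auto simp: integral_poisson_pmf_power power_le_one)
  then show ?thesis using assms(1) by (simp add: exp_sum[symmetric] sum_negf)
qed

lemma nn_integral_poisson_field_site:
  assumes "0 < \<sigma> i"
  shows "(\<integral>\<^sup>+\<eta>. ennreal (real (\<eta> i)) \<partial>poisson_field \<sigma>) = ennreal (\<sigma> i)"
proof -
  have "(\<integral>\<^sup>+\<eta>. ennreal (real (\<eta> i)) \<partial>poisson_field \<sigma>) =
      (\<integral>\<^sup>+n. ennreal (real n) \<partial>distr (poisson_field \<sigma>) (measure_pmf (poisson_pmf (\<sigma> i))) (\<lambda>\<eta>. \<eta> i))"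
    by (subst nn_integral_distr) (auto simp: poisson_field_def)
  also have "distr (poisson_field \<sigma>) (measure_pmf (poisson_pmf (\<sigma> i))) (\<lambda>\<eta>. \<eta> i) = measure_pmf (poisson_pmf (\<sigma> i))"
    unfolding poisson_field_def by (rule distr_PiM_component) (auto intro: prob_space_measure_pmf)
  finally show ?thesis by (simp add: nn_integral_poisson_pmf_mean assms)
qed

lemma sum_symmetric_interval_tendsto:
  fixes f :: "int \<Rightarrow> real"
  assumes "\<And>i. 0 \<le> f i" "0 \<le> c" "(\<integral>\<^sup>+i. ennreal (f i) \<partial>count_space UNIV) = ennreal c"
  shows "(\<lambda>N. \<Sum>i\<in>{- int N..int N}. f i) \<longlonglongrightarrow> c"
proof -
  have "(\<lambda>N. \<integral>\<^sup>+i. ennreal (f i) * indicator {- int N..int N} i \<partial>count_space UNIV)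
      \<longlonglongrightarrow> (\<integral>\<^sup>+i. ennreal (f i) \<partial>count_space UNIV)"
  proof (rule nn_integral_LIMSEQ)
    show "incseq (\<lambda>N i. ennreal (f i) * indicator {- int N..int N} i)"
      by (auto simp: incseq_def le_fun_def indicator_def)
    fix i :: int
    have "\<forall>\<^sub>F N in sequentially. ennreal (f i) = ennreal (f i) * indicator {- int N..int N} i"
      using eventually_ge_at_top[of "nat \<bar>i\<bar>"] by eventually_elim (auto simp: indicator_def)
    then show "(\<lambda>N. ennreal (f i) * indicator {- int N..int N} i) \<longlonglongrightarrow> ennreal (f i)"
      by (rule Lim_transform_eventually[OF tendsto_const])
  qed simp
  then have "(\<lambda>N. ennreal (\<Sum>i\<in>{- int N..int N}. f i)) \<longlonglongrightarrow> ennreal c"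
    unfolding assms(3) by (subst (asm) nn_integral_indicator_finite) (auto simp: assms(1))
  then show ?thesis
    by (rule tendsto_ennrealD) (use assms in \<open>auto intro!: sum_nonneg always_eventually\<close>)
qed

section \<open>Weak limits of bounded functions\<close>

text \<open>
  If the integrals of uniformly bounded functions \<open>\<Psi> n\<close> over the sets of an intersection-stable
  generator converge to \<open>c\<close> times the measure, then \<open>\<Psi> n\<close> converges weakly to \<open>c\<close> against every
  integrable \<open>h\<close>.  The admissible \<open>h\<close> are closed under limits in mean (\<open>conv_lim\<close>), which serves both for the
  disjoint unions in the Dynkin argument and for the approximation by simple functions.
\<close>
lemma integral_weak_limit_extend:
  fixes \<Psi> :: "nat \<Rightarrow> 'b \<Rightarrow> real" and c :: real
  assumes "finite_measure N"
    and gen: "sets N = sigma_sets (space N) G" "Int_stable G" "G \<subseteq> Pow (space N)"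
    and meas: "\<And>n. \<Psi> n \<in> borel_measurable N" and bound: "\<And>n x. \<bar>\<Psi> n x\<bar> \<le> 1"
    and lim_gen: "\<And>A. A \<in> G \<Longrightarrow> (\<lambda>n. \<integral>x. indicator A x * \<Psi> n x \<partial>N) \<longlonglongrightarrow> c * measure N A"
    and lim_space: "(\<lambda>n. \<integral>x. \<Psi> n x \<partial>N) \<longlonglongrightarrow> c * measure N (space N)"
    and int: "integrable N h"
  shows "(\<lambda>n. \<integral>x. h x * \<Psi> n x \<partial>N) \<longlonglongrightarrow> c * (\<integral>x. h x \<partial>N)"
proof -
  interpret finite_measure N by fact
  note meas [measurable]
  have intP: "integrable N (\<lambda>x. f x * \<Psi> n x)" if "integrable N f" for f n
  proof (rule Bochner_Integration.integrable_bound[OF that])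
    show "AE x in N. norm (f x * \<Psi> n x) \<le> norm (f x)"
      using bound by (intro AE_I2) (simp add: abs_mult mult_left_le)
  qed (use that in measurable)
  define conv where "conv f \<longleftrightarrow> (\<lambda>n. \<integral>x. f x * \<Psi> n x \<partial>N) \<longlonglongrightarrow> c * (\<integral>x. f x \<partial>N)" for f
  have conv_lim: "conv f"
    if f: "integrable N f" and s: "\<And>k. integrable N (s k)" and cs: "\<And>k. conv (s k)"
      and L1: "(\<lambda>k. \<integral>x. \<bar>f x - s k x\<bar> \<partial>N) \<longlonglongrightarrow> 0" for f s
    unfolding conv_def
  proof (rule LIMSEQ_I)
    fix e :: real assume e: "0 < e"
    define d where "d = e / (3 * (1 + \<bar>c\<bar>))"
    have d: "0 < d" "d * (1 + \<bar>c\<bar>) = e / 3" using e by (auto simp: d_def field_simps)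
    obtain k where k: "(\<integral>x. \<bar>f x - s k x\<bar> \<partial>N) < d"
      using LIMSEQ_D[OF L1 d(1)] by fastforce
    have close: "\<bar>(\<integral>x. f x * g x \<partial>N) - (\<integral>x. s k x * g x \<partial>N)\<bar> \<le> (\<integral>x. \<bar>f x - s k x\<bar> \<partial>N)"
      if g: "\<And>x. \<bar>g x\<bar> \<le> 1" "integrable N (\<lambda>x. f x * g x)" "integrable N (\<lambda>x. s k x * g x)" for g
    proof -
      have "\<bar>(\<integral>x. f x * g x \<partial>N) - (\<integral>x. s k x * g x \<partial>N)\<bar> = \<bar>\<integral>x. (f x - s k x) * g x \<partial>N\<bar>"
        using g by (simp add: left_diff_distrib)
      also have "\<dots> \<le> (\<integral>x. \<bar>(f x - s k x) * g x\<bar> \<partial>N)" by (rule integral_abs_bound)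
      also have "\<dots> \<le> (\<integral>x. \<bar>f x - s k x\<bar> \<partial>N)"
      proof (rule integral_mono)
        fix x
        show "\<bar>(f x - s k x) * g x\<bar> \<le> \<bar>f x - s k x\<bar>"
          using g(1)[of x] by (simp add: abs_mult mult_left_le)
      qed (use g f s in \<open>auto simp: left_diff_distrib\<close>)
      finally show ?thesis .
    qed
    have "conv (s k)" by (rule cs)
    then obtain n0 where n0: "\<And>n. n \<ge> n0 \<Longrightarrow> \<bar>(\<integral>x. s k x * \<Psi> n x \<partial>N) - c * (\<integral>x. s k x \<partial>N)\<bar> < e / 3"
      using LIMSEQ_D[of _ "c * (\<integral>x. s k x \<partial>N)" "e / 3"] e unfolding conv_def by fastforce
    show "\<exists>n0. \<forall>n\<ge>n0. norm ((\<integral>x. f x * \<Psi> n x \<partial>N) - c * (\<integral>x. f x \<partial>N)) < e"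
    proof (intro exI allI impI)
      fix n assume "n0 \<le> n"
      have 1: "\<bar>(\<integral>x. f x * \<Psi> n x \<partial>N) - (\<integral>x. s k x * \<Psi> n x \<partial>N)\<bar> < d"
        using close[of "\<Psi> n"] k bound intP f s by force
      have "\<bar>(\<integral>x. f x \<partial>N) - (\<integral>x. s k x \<partial>N)\<bar> \<le> d"
        using close[of "\<lambda>_. 1"] k f s by simp
      then have "\<bar>c\<bar> * \<bar>(\<integral>x. f x \<partial>N) - (\<integral>x. s k x \<partial>N)\<bar> \<le> \<bar>c\<bar> * d"
        by (intro mult_left_mono) auto
      then have 2: "\<bar>c * (\<integral>x. s k x \<partial>N) - c * (\<integral>x. f x \<partial>N)\<bar> \<le> \<bar>c\<bar> * d"
        by (simp add: abs_mult[symmetric] right_diff_distrib abs_minus_commute)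
      have "\<bar>c\<bar> * d \<le> e / 3" "d \<le> e / 3" using d e by (auto simp: algebra_simps mult_nonneg_nonneg)
      with 1 2 n0[OF \<open>n0 \<le> n\<close>] show "norm ((\<integral>x. f x * \<Psi> n x \<partial>N) - c * (\<integral>x. f x \<partial>N)) < e"
        by (simp only: real_norm_def)
    qed
  qed
  have conv_add: "conv (\<lambda>x. f x + g x)" if "conv f" "conv g" "integrable N f" "integrable N g" for f g
    using that tendsto_add[of "\<lambda>n. \<integral>x. f x * \<Psi> n x \<partial>N" _ sequentially "\<lambda>n. \<integral>x. g x * \<Psi> n x \<partial>N"]
    unfolding conv_def by (simp add: distrib_right distrib_left intP)
  have conv_scale: "conv (\<lambda>x. f x * a)" if "conv f" "integrable N f" for f a
    using that tendsto_mult_left[of "\<lambda>n. \<integral>x. f x * \<Psi> n x \<partial>N" "c * (\<integral>x. f x \<partial>N)" sequentially a]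
    unfolding conv_def by (simp add: mult_ac intP)
  have int_ind: "integrable N (indicator A :: _ \<Rightarrow> real)" if "A \<in> sets N" for A
    using that by (intro integrable_const_bound[where B=1]) auto
  have conv_1: "conv (indicator (space N))"
  proof -
    have "(\<integral>x. indicator (space N) x * \<Psi> n x \<partial>N) = (\<integral>x. \<Psi> n x \<partial>N)" for n
      by (intro Bochner_Integration.integral_cong) auto
    then show ?thesis using lim_space by (simp add: conv_def)
  qed
  have conv_ind: "conv (indicator A)" if "A \<in> sets N" for A
    using gen(2,3) that[unfolded gen(1)]
  proof (induction rule: sigma_sets_induct_disjoint)
    case (basic A)
    then have "A \<in> sets N" using gen by (auto simp: gen(1))
    then show ?case using lim_gen[OF basic] by (simp add: conv_def)
  next
    case empty
    show ?case by (simp add: conv_def)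
  next
    case (compl A)
    then have A: "A \<in> sets N" by (simp add: gen(1))
    have "conv (\<lambda>x. indicator (space N) x + indicator A x * (- 1))"
      using A compl by (intro conv_add conv_scale conv_1 int_ind integrable_mult_left) auto
    moreover have "indicator (space N) x + indicator A x * (- 1) = (indicator (space N - A) x :: real)" for x
      using sets.sets_into_space[OF A] by (auto simp: indicator_def)
    ultimately show ?case by simp
  next
    case (union A)
    then have A: "range A \<subseteq> sets N" by (simp add: gen(1))
    then have [measurable]: "A i \<in> sets N" for i by auto
    have fin: "conv (indicator (\<Union>i<k. A i)) \<and> (\<Union>i<k. A i) \<in> sets N" for k
    proof (induction k)
      case 0
      show ?case by (simp add: conv_def)
    next
      case (Suc k)
      have "A k \<inter> A i = {}" if "i < k" for i
        using disjoint_family_onD[OF union(1), of k i] that by auto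
      then have "A k \<inter> (\<Union>i<k. A i) = {}" by blast
      then have eq: "indicator (\<Union>i<Suc k. A i) = (\<lambda>x. indicator (\<Union>i<k. A i) x + (indicator (A k) x :: real))"
        by (intro ext) (auto simp: indicator_def less_Suc_eq)
      have "conv (\<lambda>x. indicator (\<Union>i<k. A i) x + indicator (A k) x)"
        using Suc union(3) by (intro conv_add int_ind) auto
      then show ?case unfolding eq using Suc by (auto simp: lessThan_Suc)
    qed
    show ?case
    proof (rule conv_lim[where s="\<lambda>k. indicator (\<Union>i<k. A i)"])
      have "(\<lambda>k. \<integral>x. \<bar>indicator (\<Union>i. A i) x - indicator (\<Union>i<k. A i) x\<bar> \<partial>N) \<longlonglongrightarrow> (\<integral>x. (0::real) \<partial>N)"
      proof (rule integral_dominated_convergence[where w="\<lambda>_. 1"])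
        show "AE x in N. (\<lambda>k. \<bar>indicator (\<Union>i. A i) x - indicator (\<Union>i<k. A i) x\<bar>) \<longlonglongrightarrow> (0::real)"
        proof (intro AE_I2 tendsto_eventually)
          fix x
          show "\<forall>\<^sub>F k in sequentially. \<bar>indicator (\<Union>i. A i) x - indicator (\<Union>i<k. A i) x\<bar> = (0::real)"
          proof (cases "x \<in> (\<Union>i. A i)")
            case True
            then obtain i where "x \<in> A i" by blast
            show ?thesis
              using eventually_gt_at_top[of i] by eventually_elim (use \<open>x \<in> A i\<close> in \<open>auto simp: indicator_def\<close>)
          qed (auto simp: indicator_def)
        qed
      qed (use fin in \<open>auto simp: indicator_def\<close>)
      then show "(\<lambda>k. \<integral>x. \<bar>indicator (\<Union>i. A i) x - indicator (\<Union>i<k. A i) x\<bar> \<partial>N) \<longlonglongrightarrow> (0::real)" by simp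
    qed (use fin A in \<open>auto intro!: int_ind\<close>)
  qed
  have "conv h"
    using int
  proof (induction rule: integrable_induct)
    case (base A c)
    then show ?case using conv_scale[OF conv_ind, of A c] by simp
  next
    case (add f g)
    then show ?case by (intro conv_add)
  next
    case (lim f s)
    show ?case
    proof (rule conv_lim[OF lim(4,1,5)])
      have "(\<lambda>k. \<integral>x. \<bar>f x - s k x\<bar> \<partial>N) \<longlonglongrightarrow> (\<integral>x. 0 \<partial>N)"
      proof (rule integral_dominated_convergence[where w="\<lambda>x. 3 * \<bar>f x\<bar>"])
        show "AE x in N. (\<lambda>k. \<bar>f x - s k x\<bar>) \<longlonglongrightarrow> 0"
          using lim(2) by (intro AE_I2 tendsto_rabs_zero) (metis tendsto_diff[OF tendsto_const] diff_self)
        show "AE x in N. norm \<bar>f x - s k x\<bar> \<le> 3 * \<bar>f x\<bar>" for k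
        proof (rule AE_I2)
          fix x assume "x \<in> space N"
          then have "\<bar>s k x\<bar> \<le> 2 * \<bar>f x\<bar>" using lim(3)[of x k] by simp
          then show "norm \<bar>f x - s k x\<bar> \<le> 3 * \<bar>f x\<bar>" by simp
        qed
      qed (use lim in auto)
      then show "(\<lambda>k. \<integral>x. \<bar>f x - s k x\<bar> \<partial>N) \<longlonglongrightarrow> 0" by simp
    qed
  qed
  then show ?thesis by (simp add: conv_def)
qed

section \<open>The particle system\<close>

text \<open>The independent noises of all the particles.\<close>
abbreviation all_noises :: "(int \<times> nat \<Rightarrow> nat \<Rightarrow> real \<times> real) measure" where
  "all_noises \<equiv> \<Pi>\<^sub>M a\<in>UNIV. noise_space"

lemma prob_space_all_noises: "prob_space all_noises"
  by (intro prob_space_PiM prob_space_noise_space)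

lemma measurable_component_position [measurable]:
  "(\<lambda>W. position p i (W a) t) \<in> all_noises \<rightarrow>\<^sub>M count_space UNIV"
proof -
  have "(\<lambda>W. W a) \<in> all_noises \<rightarrow>\<^sub>M noise_space" by (rule measurable_component_singleton) simp
  from measurable_compose[OF this measurable_position] show ?thesis .
qed

lemma measurable_system_position [measurable]:
  "(\<lambda>x. position p i (snd x a) t) \<in> (\<mu> \<Otimes>\<^sub>M all_noises) \<rightarrow>\<^sub>M count_space UNIV"
  by (rule measurable_compose[OF measurable_snd measurable_component_position])

lemma measurable_particle_event [measurable]:
  assumes [measurable_cong]: "sets \<mu> = sets config_space"
  shows "Measurable.pred (\<mu> \<Otimes>\<^sub>M all_noises) (\<lambda>x. a \<in> particles_at p t (fst x) (snd x) j)"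
proof -
  obtain i k where a: "a = (i, k)" by (cases a)
  have [measurable]: "(\<lambda>x. fst x i) \<in> (\<mu> \<Otimes>\<^sub>M all_noises) \<rightarrow>\<^sub>M count_space UNIV"
    by (rule measurable_compose[OF measurable_fst]) measurable
  show ?thesis unfolding particles_at_def a by simp
qed

lemma measurable_card_particles [measurable]:
  assumes [measurable_cong]: "sets \<mu> = sets config_space"
  shows "(\<lambda>x. card (particles_at p t (fst x) (snd x) j)) \<in> (\<mu> \<Otimes>\<^sub>M all_noises) \<rightarrow>\<^sub>M count_space UNIV"
proof -
  have "(\<lambda>x. card (to_nat ` particles_at p t (fst x) (snd x) j)) \<in> (\<mu> \<Otimes>\<^sub>M all_noises) \<rightarrow>\<^sub>M count_space UNIV"
  proof (rule measurable_card)
    fix n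
    have "Measurable.pred (\<mu> \<Otimes>\<^sub>M all_noises) (\<lambda>x. \<exists>a. a \<in> particles_at p t (fst x) (snd x) j \<and> n = to_nat a)"
      using assms by measurable
    then show "{x \<in> space (\<mu> \<Otimes>\<^sub>M all_noises). n \<in> to_nat ` particles_at p t (fst x) (snd x) j} \<in> sets (\<mu> \<Otimes>\<^sub>M all_noises)"
      by (simp add: pred_def image_iff Bex_def)
  qed
  then show ?thesis by (subst (asm) card_image) (auto simp: inj_on_def)
qed

lemma nn_integral_noise_component:
  fixes f :: "(nat \<Rightarrow> real \<times> real) \<Rightarrow> ennreal"
  assumes [measurable]: "f \<in> borel_measurable noise_space"
  shows "(\<integral>\<^sup>+W. f (W a) \<partial>all_noises) = (\<integral>\<^sup>+w. f w \<partial>noise_space)"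
proof -
  have "(\<integral>\<^sup>+w. f w \<partial>noise_space) = (\<integral>\<^sup>+w. f w \<partial>distr all_noises noise_space (\<lambda>W. W a))"
    by (subst distr_PiM_component) (auto intro: prob_space_noise_space)
  also have "\<dots> = (\<integral>\<^sup>+W. f (W a) \<partial>all_noises)" by (rule nn_integral_distr) auto
  finally show ?thesis ..
qed

context environment
begin

text \<open>The expected number of particles at \<open>j\<close> at time \<open>t\<close> is \<open>\<Sum>i. \<sigma> i * hop_prob t i j\<close>.\<close>
lemma AE_finite_particles:
  assumes prob: "prob_space \<mu>" and sets [measurable_cong]: "sets \<mu> = sets config_space"
    and mean: "\<And>i. (\<integral>\<^sup>+\<eta>. ennreal (real (\<eta> i)) \<partial>\<mu>) = ennreal (\<sigma> i)"
    and fin: "\<And>j. (\<integral>\<^sup>+i. ennreal (\<sigma> i) * ennreal (hop_prob t i j) \<partial>count_space UNIV) < \<infinity>"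
  shows "AE (\<eta>, W) in system_space \<mu>. \<forall>j. finite (particles_at p t \<eta> W j)"
proof -
  interpret mu: prob_space \<mu> by (rule prob)
  interpret W: prob_space all_noises by (rule prob_space_all_noises)
  interpret N: prob_space noise_space by (rule prob_space_noise_space)
  let ?S = "\<mu> \<Otimes>\<^sub>M all_noises"
  have meas_tail: "(\<lambda>\<eta>. indicator {k<..} (\<eta> i) :: ennreal) \<in> borel_measurable \<mu>" for k :: nat and i
  proof -
    have "(\<lambda>\<eta>. \<eta> i) \<in> \<mu> \<rightarrow>\<^sub>M count_space UNIV" by measurable
    moreover have "(indicator {k<..} :: nat \<Rightarrow> ennreal) \<in> borel_measurable (count_space UNIV)" by simp
    ultimately show ?thesis by (rule measurable_compose)
  qed
  have AE_j: "AE x in ?S. finite (particles_at p t (fst x) (snd x) j)" for j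
  proof -
    have ev: "Measurable.pred ?S (\<lambda>x. a \<in> particles_at p t (fst x) (snd x) j)" for a
      using sets by (rule measurable_particle_event)
    have [measurable]: "(\<lambda>x. indicator (particles_at p t (fst x) (snd x) j) a :: ennreal) \<in> borel_measurable ?S" for a
      using ev[of a] unfolding indicator_def by measurable
    have single: "(\<integral>\<^sup>+x. indicator (particles_at p t (fst x) (snd x) j) (i, k) \<partial>?S) =
        ennreal (hop_prob t i j) * (\<integral>\<^sup>+\<eta>. indicator {k<..} (\<eta> i) \<partial>\<mu>)" for i k
    proof -
      have "(\<integral>\<^sup>+x. indicator (particles_at p t (fst x) (snd x) j) (i, k) \<partial>?S) =
          (\<integral>\<^sup>+\<eta>. \<integral>\<^sup>+W. indicator (particles_at p t \<eta> W j) (i, k) \<partial>all_noises \<partial>\<mu>)"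
        by (subst W.nn_integral_fst[symmetric]) auto
      also have "\<dots> = (\<integral>\<^sup>+\<eta>. ennreal (hop_prob t i j) * indicator {k<..} (\<eta> i) \<partial>\<mu>)"
      proof (intro nn_integral_cong)
        fix \<eta> :: "int \<Rightarrow> nat"
        have "(\<integral>\<^sup>+W. indicator (particles_at p t \<eta> W j) (i, k) \<partial>all_noises) =
            (\<integral>\<^sup>+W. indicator {k<..} (\<eta> i) * indicator {w. position p i w t = j} (W (i, k)) \<partial>all_noises)"
          by (intro nn_integral_cong) (auto simp: indicator_def particles_at_def)
        also have "\<dots> = (\<integral>\<^sup>+w. indicator {k<..} (\<eta> i) * indicator {w. position p i w t = j} w \<partial>noise_space)"
          by (rule nn_integral_noise_component) (simp add: position_event)
        also have "\<dots> = ennreal (hop_prob t i j) * indicator {k<..} (\<eta> i)"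
          by (simp add: nn_integral_cmult position_event hop_prob_def N.emeasure_eq_measure mult.commute)
        finally show "(\<integral>\<^sup>+W. indicator (particles_at p t \<eta> W j) (i, k) \<partial>all_noises) =
            ennreal (hop_prob t i j) * indicator {k<..} (\<eta> i)" .
      qed
      also have "\<dots> = ennreal (hop_prob t i j) * (\<integral>\<^sup>+\<eta>. indicator {k<..} (\<eta> i) \<partial>\<mu>)"
        by (rule nn_integral_cmult[OF meas_tail])
      finally show ?thesis .
    qed
    have tail: "(\<integral>\<^sup>+k. (\<integral>\<^sup>+\<eta>. indicator {k<..} (\<eta> i) \<partial>\<mu>) \<partial>count_space UNIV) = ennreal (\<sigma> i)" for i
    proof -
      have "(\<integral>\<^sup>+k. (\<integral>\<^sup>+\<eta>. indicator {k<..} (\<eta> i) \<partial>\<mu>) \<partial>count_space (UNIV :: nat set)) =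
          (\<integral>\<^sup>+\<eta>. (\<integral>\<^sup>+k. indicator {k<..} (\<eta> i) \<partial>count_space UNIV) \<partial>\<mu>)"
        by (rule nn_integral_count_space_nn_integral[symmetric]) (simp_all add: meas_tail)
      also have "\<dots> = (\<integral>\<^sup>+\<eta>. ennreal (real (\<eta> i)) \<partial>\<mu>)"
      proof (intro nn_integral_cong)
        fix \<eta> :: "int \<Rightarrow> nat"
        have "(\<integral>\<^sup>+k. indicator {k<..} (\<eta> i) \<partial>count_space UNIV) = (\<integral>\<^sup>+k. indicator {..<\<eta> i} k \<partial>count_space UNIV)"
          by (intro nn_integral_cong) (auto simp: indicator_def)
        then show "(\<integral>\<^sup>+k. indicator {k<..} (\<eta> i) \<partial>count_space UNIV) = ennreal (real (\<eta> i))"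
          by (simp add: ennreal_of_nat_eq_real_of_nat)
      qed
      finally show ?thesis by (simp add: mean)
    qed
    have enum: "emeasure (count_space UNIV) A = (\<Sum>n. indicator A (from_nat_into UNIV n))" for A :: "(int \<times> nat) set"
    proof -
      have "bij_betw (from_nat_into UNIV) (UNIV :: nat set) (UNIV :: (int \<times> nat) set)"
        by (intro bij_betw_from_nat_into) (auto simp: finite_prod)
      from nn_integral_bij_count_space[OF this, of "indicator A"]
      show ?thesis by (simp add: nn_integral_count_space_nat)
    qed
    have "(\<integral>\<^sup>+x. emeasure (count_space UNIV) (particles_at p t (fst x) (snd x) j) \<partial>?S) =
        (\<integral>\<^sup>+x. (\<integral>\<^sup>+a. indicator (particles_at p t (fst x) (snd x) j) a \<partial>count_space UNIV) \<partial>?S)"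
      by simp
    also have "\<dots> = (\<integral>\<^sup>+a. (\<integral>\<^sup>+x. indicator (particles_at p t (fst x) (snd x) j) a \<partial>?S) \<partial>count_space UNIV)"
      by (rule nn_integral_count_space_nn_integral) auto
    also have "\<dots> = (\<integral>\<^sup>+i. \<integral>\<^sup>+k. (\<integral>\<^sup>+x. indicator (particles_at p t (fst x) (snd x) j) (i, k) \<partial>?S) \<partial>count_space UNIV \<partial>count_space UNIV)"
      by (rule nn_integral_fst_count_space[symmetric])
    also have "\<dots> = (\<integral>\<^sup>+i. ennreal (\<sigma> i) * ennreal (hop_prob t i j) \<partial>count_space UNIV)"
      by (simp add: single nn_integral_cmult tail mult.commute)
    also have "\<dots> < \<infinity>" by (rule fin)
    finally have "AE x in ?S. emeasure (count_space UNIV) (particles_at p t (fst x) (snd x) j) \<noteq> \<infinity>"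
      by (intro nn_integral_PInf_AE) (simp_all add: enum)
    then show ?thesis by eventually_elim (auto simp: emeasure_count_space split: if_splits)
  qed
  then show ?thesis unfolding system_space_def split_beta' AE_all_countable by blast
qed

end

lemma integral_all_noises_prod:
  fixes g :: "int \<times> nat \<Rightarrow> (nat \<Rightarrow> real \<times> real) \<Rightarrow> real"
  assumes "finite A" "\<And>a. g a \<in> borel_measurable noise_space" "\<And>a w. \<bar>g a w\<bar> \<le> 1"
  shows "(\<integral>W. (\<Prod>a\<in>A. g a (W a)) \<partial>all_noises) = (\<Prod>a\<in>A. \<integral>w. g a w \<partial>noise_space)"
proof (rule integral_PiM_prod)
  interpret N: prob_space noise_space by (rule prob_space_noise_space)
  show "integrable noise_space (g a)" for a
    using assms by (intro N.integrable_const_bound[where B=1]) auto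
qed (use assms prob_space_noise_space in auto)

text \<open>The expected weight of a particle that started at \<open>i\<close>, when a particle found at \<open>j\<close> at time \<open>t\<close> has
  weight \<open>s j\<close>.\<close>
definition mean_weight :: "(int \<Rightarrow> real) \<Rightarrow> (int \<Rightarrow> real) \<Rightarrow> real \<Rightarrow> int \<Rightarrow> real" where
  "mean_weight p s t i = (\<integral>w. s (position p i w t) \<partial>noise_space)"

lemma measurable_weight_position [measurable]:
  "(\<lambda>w. s (position p i w t)) \<in> borel_measurable noise_space" for s :: "int \<Rightarrow> real"
  by (rule measurable_compose[OF measurable_position]) simp

lemma mean_weight_bounds:
  assumes "\<And>j. 0 \<le> s j \<and> s j \<le> 1"
  shows "0 \<le> mean_weight p s t i" "mean_weight p s t i \<le> 1"
proof -
  interpret N: prob_space noise_space by (rule prob_space_noise_space)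
  show "0 \<le> mean_weight p s t i"
    unfolding mean_weight_def using assms by (intro integral_nonneg_AE) auto
  have "mean_weight p s t i \<le> (\<integral>w. 1 \<partial>noise_space)"
    unfolding mean_weight_def using assms
    by (intro integral_mono N.integrable_const_bound[where B=1]) auto
  then show "mean_weight p s t i \<le> 1" by (simp add: N.prob_space[simplified])
qed

text \<open>The product of the weights at time \<open>t\<close> of all particles that started in \<open>I\<close>.\<close>
definition window_weight :: "(int \<Rightarrow> real) \<Rightarrow> (int \<Rightarrow> real) \<Rightarrow> real \<Rightarrow> int set \<Rightarrow>
    (int \<Rightarrow> nat) \<Rightarrow> (int \<times> nat \<Rightarrow> nat \<Rightarrow> real \<times> real) \<Rightarrow> real" where
  "window_weight p s t I \<eta> W = (\<Prod>i\<in>I. \<Prod>k<\<eta> i. s (position p i (W (i, k)) t))"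

lemma window_weight_bounds:
  assumes "\<And>j. 0 \<le> s j \<and> s j \<le> 1"
  shows "\<bar>window_weight p s t I \<eta> W\<bar> \<le> 1"
  unfolding window_weight_def abs_prod using assms
  by (intro prod_le_1 conjI prod_nonneg) (auto intro!: prod_le_1)

lemma measurable_window_weight:
  assumes [measurable_cong]: "sets \<mu> = sets config_space"
  shows "(\<lambda>x. window_weight p s t I (fst x) (snd x)) \<in> borel_measurable (\<mu> \<Otimes>\<^sub>M all_noises)"
proof -
  have [measurable]: "(\<lambda>x. s (position p i (snd x a) t)) \<in> borel_measurable (\<mu> \<Otimes>\<^sub>M all_noises)" for i a
    by (rule measurable_compose[OF measurable_system_position]) simp
  have "(\<lambda>x. \<Prod>k<fst x i. s (position p i (snd x (i, k)) t)) \<in> borel_measurable (\<mu> \<Otimes>\<^sub>M all_noises)" for i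
  proof (rule measurable_compose_countable[where f="\<lambda>n x. \<Prod>k<n. s (position p i (snd x (i, k)) t)" and g="\<lambda>x. fst x i"])
    show "(\<lambda>x. fst x i) \<in> (\<mu> \<Otimes>\<^sub>M all_noises) \<rightarrow>\<^sub>M count_space UNIV"
      by (rule measurable_compose[OF measurable_fst]) measurable
  qed measurable
  then show ?thesis unfolding window_weight_def by (rule borel_measurable_prod)
qed

lemma integral_window_weight:
  assumes "prob_space \<mu>" and sets [measurable_cong]: "sets \<mu> = sets config_space"
    and s: "\<And>j. 0 \<le> s j \<and> s j \<le> 1" and I: "finite I"
  shows "(\<integral>x. window_weight p s t I (fst x) (snd x) \<partial>system_space \<mu>) =
    (\<integral>\<eta>. (\<Prod>i\<in>I. mean_weight p s t i ^ \<eta> i) \<partial>\<mu>)"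
proof -
  interpret mu: prob_space \<mu> by fact
  interpret W: prob_space all_noises by (rule prob_space_all_noises)
  interpret PS: pair_prob_space \<mu> all_noises ..
  have inner: "(\<integral>W. window_weight p s t I \<eta> W \<partial>all_noises) = (\<Prod>i\<in>I. mean_weight p s t i ^ \<eta> i)" for \<eta>
  proof -
    have "window_weight p s t I \<eta> W = (\<Prod>a\<in>(SIGMA i:I. {..<\<eta> i}). s (position p (fst a) (W a) t))" for W
      unfolding window_weight_def using I by (subst prod.Sigma) (auto simp: split_beta')
    then have "(\<integral>W. window_weight p s t I \<eta> W \<partial>all_noises) =
        (\<Prod>a\<in>(SIGMA i:I. {..<\<eta> i}). \<integral>w. s (position p (fst a) w t) \<partial>noise_space)"
      using I s by (simp add: integral_all_noises_prod[where g="\<lambda>a w. s (position p (fst a) w t)"])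
    also have "\<dots> = (\<Prod>i\<in>I. \<Prod>k<\<eta> i. mean_weight p s t i)"
      unfolding mean_weight_def using I by (subst prod.Sigma) (auto simp: split_beta')
    finally show ?thesis by simp
  qed
  have "integrable (\<mu> \<Otimes>\<^sub>M all_noises) (\<lambda>x. window_weight p s t I (fst x) (snd x))"
    using window_weight_bounds[OF s] measurable_window_weight[OF sets]
    by (intro PS.integrable_const_bound[where B=1]) auto
  from PS.integral_fst'[OF this] show ?thesis
    by (simp add: inner system_space_def)
qed

text \<open>When only finitely many particles are in \<open>J\<close> at time \<open>t\<close>, all the others have weight 1, and the
  products are constant as soon as the window contains the starting points of those in \<open>J\<close>.\<close>
lemma window_weight_tendsto:
  assumes fin: "\<And>j. finite (particles_at p t \<eta> W j)"
    and J: "finite J" and s: "\<And>j. j \<notin> J \<Longrightarrow> s j = 1"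
  shows "(\<lambda>N. window_weight p s t {- int N..int N} \<eta> W)
    \<longlonglongrightarrow> (\<Prod>j\<in>J. s j ^ card (particles_at p t \<eta> W j))"
proof -
  let ?P = "\<Union>j\<in>J. particles_at p t \<eta> W j"
  define g where "g a = s (position p (fst a) (W a) t)" for a
  have finP: "finite ?P" using J fin by auto
  have target: "(\<Prod>j\<in>J. s j ^ card (particles_at p t \<eta> W j)) = (\<Prod>a\<in>?P. g a)"
  proof -
    have "(\<Prod>a\<in>?P. g a) = (\<Prod>j\<in>J. \<Prod>a\<in>particles_at p t \<eta> W j. g a)"
      using J fin by (intro prod.UNION_disjoint) (auto simp: particles_at_def)
    also have "\<dots> = (\<Prod>j\<in>J. \<Prod>a\<in>particles_at p t \<eta> W j. s j)"
      by (intro prod.cong refl) (auto simp: particles_at_def g_def)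
    finally show ?thesis by simp
  qed
  obtain N0 where N0: "\<And>a. a \<in> ?P \<Longrightarrow> nat \<bar>fst a\<bar> \<le> N0"
    using finite_nat_set_iff_bounded_le[of "(\<lambda>a. nat \<bar>fst a\<bar>) ` ?P"] finP by auto
  have "window_weight p s t {- int N..int N} \<eta> W = (\<Prod>a\<in>?P. g a)" if "N0 \<le> N" for N
  proof -
    have "window_weight p s t {- int N..int N} \<eta> W = (\<Prod>a\<in>(SIGMA i:{- int N..int N}. {..<\<eta> i}). g a)"
      unfolding window_weight_def g_def by (subst prod.Sigma) (auto simp: split_beta')
    also have "\<dots> = (\<Prod>a\<in>?P. g a)"
    proof (rule prod.mono_neutral_right)
      show "?P \<subseteq> (SIGMA i:{- int N..int N}. {..<\<eta> i})"
      proof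
        fix a assume a: "a \<in> ?P"
        then have "snd a < \<eta> (fst a)" by (auto simp: particles_at_def)
        moreover have "\<bar>fst a\<bar> \<le> int N" using N0[OF a] that by linarith
        ultimately show "a \<in> (SIGMA i:{- int N..int N}. {..<\<eta> i})" by (cases a) auto
      qed
      show "\<forall>a\<in>(SIGMA i:{- int N..int N}. {..<\<eta> i}) - ?P. g a = 1"
        unfolding g_def using s by (fastforce simp: particles_at_def)
    qed simp
    finally show ?thesis .
  qed
  then have "\<forall>\<^sub>F N in sequentially. window_weight p s t {- int N..int N} \<eta> W =
      (\<Prod>j\<in>J. s j ^ card (particles_at p t \<eta> W j))"
    unfolding target eventually_sequentially by blast
  then show ?thesis by (rule tendsto_eventually)
qed

lemma measurable_generating_functional [measurable]:
  "(\<lambda>\<eta>. \<Prod>j\<in>J. (s j :: real) ^ \<eta> j) \<in> borel_measurable config_space"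
  by measurable

text \<open>The generating functional of the configuration at time \<open>t\<close>, expressed through the initial law.\<close>
lemma generating_functional_system_limit:
  assumes prob: "prob_space \<mu>" and sets [measurable_cong]: "sets \<mu> = sets config_space"
    and fin: "AE (\<eta>, W) in system_space \<mu>. \<forall>j. finite (particles_at p t \<eta> W j)"
    and J: "finite J" and s: "\<And>j. 0 \<le> s j \<and> s j \<le> 1" "\<And>j. j \<notin> J \<Longrightarrow> s j = 1"
  shows "(\<lambda>N. \<integral>\<eta>. (\<Prod>i\<in>{- int N..int N}. mean_weight p s t i ^ \<eta> i) \<partial>\<mu>) \<longlonglongrightarrow>
    (\<integral>\<eta>. (\<Prod>j\<in>J. s j ^ \<eta> j) \<partial>distr (system_space \<mu>) config_space (\<lambda>(\<eta>, W) j. card (particles_at p t \<eta> W j)))"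
proof -
  interpret mu: prob_space \<mu> by fact
  interpret W: prob_space all_noises by (rule prob_space_all_noises)
  interpret PS: pair_prob_space \<mu> all_noises ..
  have meas: "(\<lambda>x j. card (particles_at p t (fst x) (snd x) j)) \<in> system_space \<mu> \<rightarrow>\<^sub>M config_space"
    unfolding system_space_def by (intro measurable_PiM_single') (auto simp: measurable_card_particles[OF sets])
  have "(\<lambda>N. \<integral>x. window_weight p s t {- int N..int N} (fst x) (snd x) \<partial>system_space \<mu>) \<longlonglongrightarrow>
      (\<integral>x. (\<Prod>j\<in>J. s j ^ card (particles_at p t (fst x) (snd x) j)) \<partial>system_space \<mu>)"
  proof (rule integral_dominated_convergence[where w="\<lambda>_. 1"])
    show "AE x in system_space \<mu>. (\<lambda>N. window_weight p s t {- int N..int N} (fst x) (snd x)) \<longlonglongrightarrow>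
        (\<Prod>j\<in>J. s j ^ card (particles_at p t (fst x) (snd x) j))"
      using fin by eventually_elim (auto intro!: window_weight_tendsto J s(2))
    show "(\<lambda>x. \<Prod>j\<in>J. s j ^ card (particles_at p t (fst x) (snd x) j)) \<in> borel_measurable (system_space \<mu>)"
      using measurable_compose[OF meas measurable_generating_functional] .
    show "integrable (system_space \<mu>) (\<lambda>_. 1 :: real)" by (simp add: system_space_def)
    show "AE x in system_space \<mu>. norm (window_weight p s t {- int N..int N} (fst x) (snd x)) \<le> 1" for N
      using window_weight_bounds[OF s(1)] by simp
    show "(\<lambda>x. window_weight p s t {- int N..int N} (fst x) (snd x)) \<in> borel_measurable (system_space \<mu>)" for N
      unfolding system_space_def by (rule measurable_window_weight[OF sets])
  qed
  also have "(\<integral>x. (\<Prod>j\<in>J. s j ^ card (particles_at p t (fst x) (snd x) j)) \<partial>system_space \<mu>) =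
      (\<integral>\<eta>. (\<Prod>j\<in>J. s j ^ \<eta> j) \<partial>distr (system_space \<mu>) config_space (\<lambda>(\<eta>, W) j. card (particles_at p t \<eta> W j)))"
    unfolding split_beta' by (rule integral_distr[OF meas measurable_generating_functional, symmetric])
  finally show ?thesis
    by (simp add: integral_window_weight[OF prob sets s(1)])
qed

section \<open>Stationarity of the Poisson field\<close>

text \<open>Intensities \<open>\<sigma>\<close> that form an invariant measure of the one-particle chain.\<close>
locale stationary_intensity = environment +
  fixes \<sigma> :: "int \<Rightarrow> real"
  assumes intensity_pos: "\<And>i. 0 < \<sigma> i"
    and balance: "\<And>i. \<sigma> i = \<sigma> (i - 1) * p (i - 1) + \<sigma> (i + 1) * (1 - p (i + 1))"
begin

lemma mean_weight_eq:
  assumes J: "finite J" and s: "\<And>j. j \<notin> J \<Longrightarrow> s j = 1"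
  shows "mean_weight p s t i = 1 - (\<Sum>j\<in>J. (1 - s j) * hop_prob t i j)"
proof -
  interpret N: prob_space noise_space by (rule prob_space_noise_space)
  define e where "e j w = (indicator {w. position p i w t = j} w :: real)" for j w
  have int: "integrable noise_space (e j)" for j
    unfolding e_def by (intro N.integrable_const_bound[where B=1]) (auto simp: position_event)
  have e: "(\<integral>w. e j w \<partial>noise_space) = hop_prob t i j" for j
    by (simp add: e_def hop_prob_def position_event)
  have "s (position p i w t) = 1 - (\<Sum>j\<in>J. (1 - s j) * e j w)" for w
  proof -
    have "(\<Sum>j\<in>J. (1 - s j) * e j w) = (\<Sum>j\<in>J. if position p i w t = j then 1 - s j else 0)"
      by (intro sum.cong) (auto simp: e_def)
    then show ?thesis using J s by auto
  qed
  then have "mean_weight p s t i = (\<integral>w. 1 - (\<Sum>j\<in>J. (1 - s j) * e j w) \<partial>noise_space)"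
    unfolding mean_weight_def by simp
  also have "\<dots> = 1 - (\<Sum>j\<in>J. (1 - s j) * (\<integral>w. e j w \<partial>noise_space))"
    using int by (simp add: Bochner_Integration.integral_sum N.prob_space[simplified])
  finally show ?thesis by (simp only: e)
qed

lemma sum_intensity_weight_tendsto:
  assumes J: "finite J" and s: "\<And>j. j \<notin> J \<Longrightarrow> s j = 1"
  shows "(\<lambda>N. \<Sum>i\<in>{- int N..int N}. \<sigma> i * (1 - mean_weight p s t i)) \<longlonglongrightarrow> (\<Sum>j\<in>J. \<sigma> j * (1 - s j))"
proof -
  have mw: "mean_weight p s t i = 1 - (\<Sum>j\<in>J. (1 - s j) * hop_prob t i j)" for i
    by (rule mean_weight_eq[OF J s])
  have "(\<lambda>N. \<Sum>i\<in>{- int N..int N}. \<sigma> i * hop_prob t i j) \<longlonglongrightarrow> \<sigma> j" for j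
  proof (rule sum_symmetric_interval_tendsto)
    have "(\<integral>\<^sup>+i. ennreal (\<sigma> i * hop_prob t i j) \<partial>count_space UNIV) =
        (\<integral>\<^sup>+i. ennreal (\<sigma> i) * ennreal (hop_prob t i j) \<partial>count_space UNIV)"
      using intensity_pos by (intro nn_integral_cong ennreal_mult) (auto simp: hop_prob_def less_imp_le)
    then show "(\<integral>\<^sup>+i. ennreal (\<sigma> i * hop_prob t i j) \<partial>count_space UNIV) = ennreal (\<sigma> j)"
      using nn_integral_hop_prob_stationary[of \<sigma>] intensity_pos balance less_imp_le by metis
  qed (use intensity_pos in \<open>auto simp: hop_prob_def less_imp_le\<close>)
  then have "(\<lambda>N. \<Sum>j\<in>J. (1 - s j) * (\<Sum>i\<in>{- int N..int N}. \<sigma> i * hop_prob t i j)) \<longlonglongrightarrow>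
      (\<Sum>j\<in>J. (1 - s j) * \<sigma> j)"
    by (intro tendsto_sum tendsto_mult_left)
  also have "(\<lambda>N. \<Sum>j\<in>J. (1 - s j) * (\<Sum>i\<in>{- int N..int N}. \<sigma> i * hop_prob t i j)) =
      (\<lambda>N. \<Sum>i\<in>{- int N..int N}. \<sigma> i * (1 - mean_weight p s t i))"
  proof
    fix N
    have "(\<Sum>j\<in>J. (1 - s j) * (\<Sum>i\<in>{- int N..int N}. \<sigma> i * hop_prob t i j)) =
        (\<Sum>i\<in>{- int N..int N}. \<Sum>j\<in>J. (1 - s j) * (\<sigma> i * hop_prob t i j))"
      unfolding sum_distrib_left by (rule sum.swap)
    also have "\<dots> = (\<Sum>i\<in>{- int N..int N}. \<sigma> i * (1 - mean_weight p s t i))"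
      unfolding mw by (intro sum.cong refl) (simp add: sum_distrib_left mult.left_commute)
    finally show "(\<Sum>j\<in>J. (1 - s j) * (\<Sum>i\<in>{- int N..int N}. \<sigma> i * hop_prob t i j)) =
        (\<Sum>i\<in>{- int N..int N}. \<sigma> i * (1 - mean_weight p s t i))" .
  qed
  finally show ?thesis by (simp add: mult.commute)
qed

lemma poisson_field_finite_particles:
  "AE (\<eta>, W) in system_space (poisson_field \<sigma>). \<forall>j. finite (particles_at p t \<eta> W j)"
proof (rule AE_finite_particles[where \<sigma>=\<sigma>])
  show "(\<integral>\<^sup>+i. ennreal (\<sigma> i) * ennreal (hop_prob t i j) \<partial>count_space UNIV) < \<infinity>" for j
    using nn_integral_hop_prob_stationary[of \<sigma> t j] intensity_pos balance less_imp_le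
    by (metis ennreal_less_top infinity_ennreal_def)
qed (auto simp: prob_space_poisson_field sets_poisson_field nn_integral_poisson_field_site intensity_pos)

lemma stationary_poisson_field: "stationary p (poisson_field \<sigma>)"
proof -
  let ?\<mu> = "poisson_field \<sigma>"
  interpret mu: prob_space ?\<mu> by (rule prob_space_poisson_field)
  interpret W: prob_space all_noises by (rule prob_space_all_noises)
  interpret PS: pair_prob_space ?\<mu> all_noises ..
  have "distr (system_space ?\<mu>) config_space (\<lambda>(\<eta>, W) j. card (particles_at p t \<eta> W j)) = ?\<mu>" (is "?D = _") for t
  proof (rule config_measure_eqI)
    have meas: "(\<lambda>(\<eta>, W) j. card (particles_at p t \<eta> W j)) \<in> system_space ?\<mu> \<rightarrow>\<^sub>M config_space"
      unfolding system_space_def split_beta'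
      by (intro measurable_PiM_single') (auto simp: measurable_card_particles[OF sets_poisson_field])
    show "finite_measure ?D"
      by (intro finite_measure.finite_measure_distr meas) (simp add: system_space_def PS.finite_measure)
    fix J :: "int set" and s :: "int \<Rightarrow> real"
    assume J: "finite J" and s: "\<And>j. 0 \<le> s j \<and> s j \<le> 1"
    define s' where "s' j = (if j \<in> J then s j else 1)" for j
    have s': "\<And>j. 0 \<le> s' j \<and> s' j \<le> 1" "\<And>j. j \<notin> J \<Longrightarrow> s' j = 1" using s by (auto simp: s'_def)
    have eq: "(\<Prod>j\<in>J. s j ^ \<eta> j) = (\<Prod>j\<in>J. s' j ^ \<eta> j)" for \<eta> :: "int \<Rightarrow> nat"
      by (intro prod.cong) (auto simp: s'_def)
    have a: "(\<lambda>N. \<integral>\<eta>. (\<Prod>i\<in>{- int N..int N}. mean_weight p s' t i ^ \<eta> i) \<partial>?\<mu>) \<longlonglongrightarrow>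
        (\<integral>\<eta>. (\<Prod>j\<in>J. s' j ^ \<eta> j) \<partial>?D)"
      by (intro generating_functional_system_limit prob_space_poisson_field sets_poisson_field
          poisson_field_finite_particles J s')
    have b: "(\<lambda>N. \<integral>\<eta>. (\<Prod>i\<in>{- int N..int N}. mean_weight p s' t i ^ \<eta> i) \<partial>?\<mu>) \<longlonglongrightarrow>
        exp (- (\<Sum>j\<in>J. \<sigma> j * (1 - s' j)))"
      using mean_weight_bounds[OF s'(1)] intensity_pos
      by (subst integral_poisson_field_power) (auto intro!: tendsto_intros sum_intensity_weight_tendsto J s')
    have c: "exp (- (\<Sum>j\<in>J. \<sigma> j * (1 - s' j))) = (\<integral>\<eta>. (\<Prod>j\<in>J. s' j ^ \<eta> j) \<partial>?\<mu>)"
      by (rule integral_poisson_field_power[symmetric]) (use J s' intensity_pos in auto)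
    show "(\<integral>\<eta>. (\<Prod>j\<in>J. s j ^ \<eta> j) \<partial>?D) = (\<integral>\<eta>. (\<Prod>j\<in>J. s j ^ \<eta> j) \<partial>?\<mu>)"
      by (simp only: eq LIMSEQ_unique[OF a b] c)
  qed (auto simp: sets_poisson_field mu.finite_measure)
  then show ?thesis
    unfolding stationary_def
    using prob_space_poisson_field sets_poisson_field poisson_field_finite_particles by blast
qed

end

section \<open>Mixing and extremality\<close>

text \<open>The conditional expectation, given the initial configuration \<open>\<eta>\<close>, of the product of the weights
  of all particles at time \<open>t\<close>.  The infinite product over the sites is a decreasing limit
  over symmetric windows.\<close>
definition later_functional :: "(int \<Rightarrow> real) \<Rightarrow> (int \<Rightarrow> real) \<Rightarrow> real \<Rightarrow> (int \<Rightarrow> nat) \<Rightarrow> real" where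
  "later_functional p s t \<eta> = lim (\<lambda>N. \<Prod>i\<in>{- int N..int N}. mean_weight p s t i ^ \<eta> i)"

lemma later_functional:
  assumes s: "\<And>j. 0 \<le> s j \<and> s j \<le> 1"
  shows later_functional_LIMSEQ:
      "(\<lambda>N. \<Prod>i\<in>{- int N..int N}. mean_weight p s t i ^ \<eta> i) \<longlonglongrightarrow> later_functional p s t \<eta>"
    and later_functional_bounds: "\<bar>later_functional p s t \<eta>\<bar> \<le> 1"
proof -
  define F where "F N = (\<Prod>i\<in>{- int N..int N}. mean_weight p s t i ^ \<eta> i)" for N :: nat
  have F01: "0 \<le> F N" "F N \<le> 1" for N
    unfolding F_def using mean_weight_bounds[OF s] by (auto intro!: prod_nonneg prod_le_1 power_le_one)
  have "decseq F"
  proof (rule decseq_SucI)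
    fix N
    have "F (Suc N) = (\<Prod>i\<in>{- int (Suc N)..int (Suc N)} - {- int N..int N}. mean_weight p s t i ^ \<eta> i) * F N"
      unfolding F_def by (rule prod.subset_diff) auto
    also have "\<dots> \<le> 1 * F N"
      using F01[of N] mean_weight_bounds[OF s]
      by (intro mult_right_mono prod_le_1) (auto intro!: power_le_one)
    finally show "F (Suc N) \<le> F N" by simp
  qed
  then have "convergent F" using F01(1) by (metis decseq_convergent convergentI)
  then have lim: "F \<longlonglongrightarrow> lim F" by (simp add: convergent_LIMSEQ_iff)
  then show "(\<lambda>N. \<Prod>i\<in>{- int N..int N}. mean_weight p s t i ^ \<eta> i) \<longlonglongrightarrow> later_functional p s t \<eta>"
    by (simp add: F_def[abs_def] later_functional_def)
  have "0 \<le> lim F" by (rule LIMSEQ_le_const[OF lim]) (use F01 in blast)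
  moreover have "lim F \<le> 1" by (rule LIMSEQ_le_const2[OF lim]) (use F01 in blast)
  ultimately have "\<bar>lim F\<bar> \<le> 1" by simp
  then show "\<bar>later_functional p s t \<eta>\<bar> \<le> 1"
    by (simp add: F_def[abs_def] later_functional_def)
qed

lemma measurable_later_functional [measurable]:
  assumes s: "\<And>j. 0 \<le> s j \<and> s j \<le> 1"
  shows "later_functional p s t \<in> borel_measurable config_space"
  by (rule borel_measurable_LIMSEQ_real[OF later_functional_LIMSEQ[OF s]]) measurable

lemma integral_window_tendsto_later_functional:
  fixes f :: "(int \<Rightarrow> nat) \<Rightarrow> real"
  assumes "finite_measure \<mu>" and sets [measurable_cong]: "sets \<mu> = sets config_space"
    and s: "\<And>j. 0 \<le> s j \<and> s j \<le> 1" and f: "integrable \<mu> f"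
  shows "(\<lambda>N. \<integral>\<eta>. f \<eta> * (\<Prod>i\<in>{- int N..int N}. mean_weight p s t i ^ \<eta> i) \<partial>\<mu>) \<longlonglongrightarrow>
    (\<integral>\<eta>. f \<eta> * later_functional p s t \<eta> \<partial>\<mu>)"
proof (rule integral_dominated_convergence[where w="\<lambda>\<eta>. \<bar>f \<eta>\<bar>"])
  have [measurable]: "f \<in> borel_measurable \<mu>" using f by simp
  have "later_functional p s t \<in> borel_measurable \<mu>"
    using measurable_later_functional[OF s] by (simp cong: measurable_cong_sets add: sets)
  then show "(\<lambda>\<eta>. f \<eta> * later_functional p s t \<eta>) \<in> borel_measurable \<mu>" by measurable
  show "(\<lambda>\<eta>. f \<eta> * (\<Prod>i\<in>{- int N..int N}. mean_weight p s t i ^ \<eta> i)) \<in> borel_measurable \<mu>" for N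
    by measurable
  show "AE \<eta> in \<mu>. (\<lambda>N. f \<eta> * (\<Prod>i\<in>{- int N..int N}. mean_weight p s t i ^ \<eta> i)) \<longlonglongrightarrow>
      f \<eta> * later_functional p s t \<eta>"
    by (intro AE_I2 tendsto_mult_left later_functional_LIMSEQ s)
  show "AE \<eta> in \<mu>. norm (f \<eta> * (\<Prod>i\<in>{- int N..int N}. mean_weight p s t i ^ \<eta> i)) \<le> \<bar>f \<eta>\<bar>" for N
  proof (rule AE_I2)
    fix \<eta>
    have "\<bar>\<Prod>i\<in>{- int N..int N}. mean_weight p s t i ^ \<eta> i\<bar> \<le> 1"
      unfolding abs_prod using mean_weight_bounds[OF s]
      by (intro prod_le_1) (auto intro!: power_le_one)
    then show "norm (f \<eta> * (\<Prod>i\<in>{- int N..int N}. mean_weight p s t i ^ \<eta> i)) \<le> \<bar>f \<eta>\<bar>"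
      by (simp add: abs_mult mult_left_le)
  qed
qed (use f in simp)

text \<open>A stationary law \<open>\<mu>\<close> need not have finite means here: only its invariance is used.\<close>
lemma stationary_later_functional:
  assumes "stationary p \<mu>" "0 \<le> t"
    and J: "finite J" and s: "\<And>j. 0 \<le> s j \<and> s j \<le> 1" "\<And>j. j \<notin> J \<Longrightarrow> s j = 1"
  shows "(\<integral>\<eta>. later_functional p s t \<eta> \<partial>\<mu>) = (\<integral>\<eta>. (\<Prod>j\<in>J. s j ^ \<eta> j) \<partial>\<mu>)"
proof -
  have prob: "prob_space \<mu>" and sets: "sets \<mu> = sets config_space"
    and fin: "AE (\<eta>, W) in system_space \<mu>. \<forall>j. finite (particles_at p t \<eta> W j)"
    and inv: "distr (system_space \<mu>) config_space (\<lambda>(\<eta>, W) j. card (particles_at p t \<eta> W j)) = \<mu>"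
    using assms(1,2) by (auto simp: stationary_def)
  interpret prob_space \<mu> by (rule prob)
  have "(\<lambda>N. \<integral>\<eta>. (\<Prod>i\<in>{- int N..int N}. mean_weight p s t i ^ \<eta> i) \<partial>\<mu>) \<longlonglongrightarrow> (\<integral>\<eta>. (\<Prod>j\<in>J. s j ^ \<eta> j) \<partial>\<mu>)"
    using generating_functional_system_limit[OF prob sets fin J s] unfolding inv .
  moreover have "(\<lambda>N. \<integral>\<eta>. (\<Prod>i\<in>{- int N..int N}. mean_weight p s t i ^ \<eta> i) \<partial>\<mu>) \<longlonglongrightarrow>
      (\<integral>\<eta>. later_functional p s t \<eta> \<partial>\<mu>)"
    using integral_window_tendsto_later_functional[OF finite_measure sets s(1), of "\<lambda>_. 1"] by simp
  ultimately show ?thesis by (rule LIMSEQ_unique[symmetric])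
qed

context stationary_intensity
begin

text \<open>Under the Poisson field the sites in \<open>I\<close> and the others contribute separately.  The
  factors \<open>exp (\<sigma> i * (1 - v i))\<close> compensate for the sites of \<open>I\<close> in the total exponent
  \<open>\<Sum>i. \<sigma> i * (1 - v i)\<close>, which is \<open>\<Sum>j\<in>J. \<sigma> j * (1 - s j)\<close> at all times.\<close>
lemma integral_cylinder_later_functional:
  assumes I: "finite I" and A: "A = prod_emb UNIV (\<lambda>_. count_space UNIV) I (Pi\<^sub>E I B)"
    and J: "finite J" and s: "\<And>j. 0 \<le> s j \<and> s j \<le> 1" "\<And>j. j \<notin> J \<Longrightarrow> s j = 1"
  shows "(\<integral>\<eta>. indicator A \<eta> * later_functional p s t \<eta> \<partial>poisson_field \<sigma>) =
    (\<Prod>i\<in>I. (\<integral>k. indicator (B i) k * mean_weight p s t i ^ k \<partial>measure_pmf (poisson_pmf (\<sigma> i))) *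
      exp (\<sigma> i * (1 - mean_weight p s t i))) * exp (- (\<Sum>j\<in>J. \<sigma> j * (1 - s j)))"
proof -
  let ?\<mu> = "poisson_field \<sigma>" and ?v = "mean_weight p s t"
  interpret mu: prob_space ?\<mu> by (rule prob_space_poisson_field)
  define c where "c i k = (if i \<in> I then indicator (B i) k else 1) * ?v i ^ k" for i k
  define G where "G i = (\<integral>k. indicator (B i) k * ?v i ^ k \<partial>measure_pmf (poisson_pmf (\<sigma> i)))" for i
  have v: "0 \<le> ?v i" "?v i \<le> 1" for i using mean_weight_bounds[OF s(1)] by auto
  have c_bound: "\<bar>c i k\<bar> \<le> 1" for i k
    using v[of i] by (auto simp: c_def indicator_def power_le_one)
  have A_sets: "A \<in> sets ?\<mu>"
    unfolding A sets_poisson_field using I by (intro sets_PiM_I) auto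
  obtain N0 where N0: "\<And>i. i \<in> I \<Longrightarrow> nat \<bar>i\<bar> \<le> N0"
    using finite_nat_set_iff_bounded_le[of "(\<lambda>i. nat \<bar>i\<bar>) ` I"] I by auto
  have window: "(\<integral>\<eta>. indicator A \<eta> * (\<Prod>i\<in>{- int N..int N}. ?v i ^ \<eta> i) \<partial>?\<mu>) =
      (\<Prod>i\<in>I. G i * exp (\<sigma> i * (1 - ?v i))) * exp (- (\<Sum>i\<in>{- int N..int N}. \<sigma> i * (1 - ?v i)))"
    if "N0 \<le> N" for N
  proof -
    let ?W = "{- int N..int N}"
    have sub: "I \<subseteq> ?W"
    proof
      fix i assume "i \<in> I"
      with N0[of i] that have "\<bar>i\<bar> \<le> int N" by linarith
      then show "i \<in> ?W" by auto
    qed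
    have "indicator A \<eta> * (\<Prod>i\<in>?W. ?v i ^ \<eta> i) = (\<Prod>i\<in>?W. c i (\<eta> i))" for \<eta>
    proof -
      have "(\<Prod>i\<in>?W. (if i \<in> I then indicator (B i) (\<eta> i) else 1)) = (\<Prod>i\<in>I. indicator (B i) (\<eta> i) :: real)"
        using sub by (subst prod.mono_neutral_right[of ?W I]) (auto intro!: prod.cong)
      also have "\<dots> = indicator A \<eta>"
        using I by (auto simp: A indicator_def prod_emb_def space_PiM Pi_iff intro!: prod.neutral)
      finally show ?thesis unfolding c_def prod.distrib by simp
    qed
    then have "(\<integral>\<eta>. indicator A \<eta> * (\<Prod>i\<in>?W. ?v i ^ \<eta> i) \<partial>?\<mu>) =
        (\<Prod>i\<in>?W. \<integral>k. c i k \<partial>measure_pmf (poisson_pmf (\<sigma> i)))"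
      using c_bound by (simp add: integral_poisson_field_prod)
    also have "\<dots> = (\<Prod>i\<in>?W. (if i \<in> I then G i * exp (\<sigma> i * (1 - ?v i)) else 1) * exp (- (\<sigma> i * (1 - ?v i))))"
    proof (intro prod.cong refl)
      fix i
      show "(\<integral>k. c i k \<partial>measure_pmf (poisson_pmf (\<sigma> i))) =
          (if i \<in> I then G i * exp (\<sigma> i * (1 - ?v i)) else 1) * exp (- (\<sigma> i * (1 - ?v i)))"
        using integral_poisson_pmf_power[OF intensity_pos v(1)[of i], of i]
        by (auto simp: c_def G_def exp_minus)
    qed
    also have "\<dots> = (\<Prod>i\<in>I. G i * exp (\<sigma> i * (1 - ?v i))) * exp (- (\<Sum>i\<in>?W. \<sigma> i * (1 - ?v i)))"
    proof -
      have "(\<Prod>i\<in>?W. if i \<in> I then G i * exp (\<sigma> i * (1 - ?v i)) else 1) = (\<Prod>i\<in>I. G i * exp (\<sigma> i * (1 - ?v i)))"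
        using sub by (subst prod.mono_neutral_right[of ?W I]) (auto intro!: prod.cong)
      then show ?thesis unfolding prod.distrib by (simp add: exp_sum[symmetric] sum_negf)
    qed
    finally show ?thesis .
  qed
  have "(\<lambda>N. \<integral>\<eta>. indicator A \<eta> * (\<Prod>i\<in>{- int N..int N}. ?v i ^ \<eta> i) \<partial>?\<mu>) \<longlonglongrightarrow>
      (\<integral>\<eta>. indicator A \<eta> * later_functional p s t \<eta> \<partial>?\<mu>)"
    using A_sets
    by (intro integral_window_tendsto_later_functional mu.finite_measure sets_poisson_field s
      mu.integrable_const_bound[where B=1]) auto
  moreover have "(\<lambda>N. \<integral>\<eta>. indicator A \<eta> * (\<Prod>i\<in>{- int N..int N}. ?v i ^ \<eta> i) \<partial>?\<mu>) \<longlonglongrightarrow>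
      (\<Prod>i\<in>I. G i * exp (\<sigma> i * (1 - ?v i))) * exp (- (\<Sum>j\<in>J. \<sigma> j * (1 - s j)))"
  proof (rule Lim_transform_eventually)
    show "(\<lambda>N. (\<Prod>i\<in>I. G i * exp (\<sigma> i * (1 - ?v i))) * exp (- (\<Sum>i\<in>{- int N..int N}. \<sigma> i * (1 - ?v i)))) \<longlonglongrightarrow>
        (\<Prod>i\<in>I. G i * exp (\<sigma> i * (1 - ?v i))) * exp (- (\<Sum>j\<in>J. \<sigma> j * (1 - s j)))"
      by (intro tendsto_intros sum_intensity_weight_tendsto J s)
    show "\<forall>\<^sub>F N in sequentially. (\<Prod>i\<in>I. G i * exp (\<sigma> i * (1 - ?v i))) *
        exp (- (\<Sum>i\<in>{- int N..int N}. \<sigma> i * (1 - ?v i))) =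
        (\<integral>\<eta>. indicator A \<eta> * (\<Prod>i\<in>{- int N..int N}. ?v i ^ \<eta> i) \<partial>?\<mu>)"
      using eventually_ge_at_top[of N0] by eventually_elim (simp add: window)
  qed
  ultimately show ?thesis unfolding G_def by (rule LIMSEQ_unique)
qed

lemma later_functional_mixing:
  assumes transient: "\<And>i j. (\<lambda>n. hop_prob (real n) i j) \<longlonglongrightarrow> 0"
    and J: "finite J" and s: "\<And>j. 0 \<le> s j \<and> s j \<le> 1" "\<And>j. j \<notin> J \<Longrightarrow> s j = 1"
    and h: "integrable (poisson_field \<sigma>) h"
  shows "(\<lambda>n. \<integral>\<eta>. h \<eta> * later_functional p s (real n) \<eta> \<partial>poisson_field \<sigma>) \<longlonglongrightarrow>
    exp (- (\<Sum>j\<in>J. \<sigma> j * (1 - s j))) * (\<integral>\<eta>. h \<eta> \<partial>poisson_field \<sigma>)"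
proof -
  let ?\<mu> = "poisson_field \<sigma>" and ?G = "prod_algebra UNIV (\<lambda>_::int. count_space (UNIV :: nat set))"
  let ?c = "exp (- (\<Sum>j\<in>J. \<sigma> j * (1 - s j)))"
  interpret mu: prob_space ?\<mu> by (rule prob_space_poisson_field)
  have sp: "space ?\<mu> = UNIV" by (rule space_config_space[OF sets_poisson_field])
  have weight: "(\<lambda>n. mean_weight p s (real n) i) \<longlonglongrightarrow> 1" for i
  proof -
    have "(\<lambda>n. 1 - (\<Sum>j\<in>J. (1 - s j) * hop_prob (real n) i j)) \<longlonglongrightarrow> 1 - (\<Sum>j\<in>J. (1 - s j) * 0)"
      by (intro tendsto_intros transient)
    moreover have "mean_weight p s (real n) i = 1 - (\<Sum>j\<in>J. (1 - s j) * hop_prob (real n) i j)" for n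
      by (rule mean_weight_eq[OF J s(2)])
    ultimately show ?thesis by simp
  qed
  have power_weight: "(\<lambda>n. mean_weight p s (real n) i ^ k) \<longlonglongrightarrow> 1" for i k
    using tendsto_power[OF weight, of i k] by simp
  have v: "0 \<le> mean_weight p s t i" "mean_weight p s t i \<le> 1" for t i
    using mean_weight_bounds[OF s(1)] by auto
  have site: "(\<lambda>n. (\<integral>k. indicator (B i) k * mean_weight p s (real n) i ^ k \<partial>measure_pmf (poisson_pmf (\<sigma> i))) *
      exp (\<sigma> i * (1 - mean_weight p s (real n) i))) \<longlonglongrightarrow> measure (measure_pmf (poisson_pmf (\<sigma> i))) (B i)"
    for B and i :: int
  proof -
    have "(\<lambda>n. \<integral>k. indicator (B i) k * mean_weight p s (real n) i ^ k \<partial>measure_pmf (poisson_pmf (\<sigma> i))) \<longlonglongrightarrow>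
        (\<integral>k. indicator (B i) k * 1 ^ k \<partial>measure_pmf (poisson_pmf (\<sigma> i)))"
      by (rule integral_dominated_convergence[where w="\<lambda>_. 1"])
        (use v in \<open>auto intro!: AE_I2 power_weight simp: indicator_def power_le_one\<close>)
    then have "(\<lambda>n. (\<integral>k. indicator (B i) k * mean_weight p s (real n) i ^ k \<partial>measure_pmf (poisson_pmf (\<sigma> i))) *
        exp (\<sigma> i * (1 - mean_weight p s (real n) i))) \<longlonglongrightarrow>
        (\<integral>k. indicator (B i) k * 1 ^ k \<partial>measure_pmf (poisson_pmf (\<sigma> i))) * exp (\<sigma> i * (1 - 1))"
      by (intro tendsto_intros weight)
    then show ?thesis by simp
  qed
  have cyl: "(\<lambda>n. \<integral>\<eta>. indicator A \<eta> * later_functional p s (real n) \<eta> \<partial>?\<mu>) \<longlonglongrightarrow> ?c * measure ?\<mu> A"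
    if I: "finite I" and A: "A = prod_emb UNIV (\<lambda>_. count_space UNIV) I (Pi\<^sub>E I B)" for A I B
  proof -
    have "measure ?\<mu> A = (\<Prod>i\<in>I. measure (measure_pmf (poisson_pmf (\<sigma> i))) (B i))"
    proof -
      have "A = prod_emb UNIV (\<lambda>i. measure_pmf (poisson_pmf (\<sigma> i))) I (Pi\<^sub>E I B)"
        by (simp add: A prod_emb_def)
      then have "emeasure ?\<mu> A = (\<Prod>i\<in>I. emeasure (measure_pmf (poisson_pmf (\<sigma> i))) (B i))"
        unfolding poisson_field_def using I
        by (simp add: emeasure_PiM_emb prob_space_measure_pmf)
      then show ?thesis
        by (simp add: mu.emeasure_eq_measure measure_pmf.emeasure_eq_measure prod_ennreal prod_nonneg)
    qed
    moreover have "(\<integral>\<eta>. indicator A \<eta> * later_functional p s (real n) \<eta> \<partial>?\<mu>) =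
        (\<Prod>i\<in>I. (\<integral>k. indicator (B i) k * mean_weight p s (real n) i ^ k \<partial>measure_pmf (poisson_pmf (\<sigma> i))) *
          exp (\<sigma> i * (1 - mean_weight p s (real n) i))) * ?c" for n
      by (rule integral_cylinder_later_functional[OF I A J s])
    moreover have "(\<lambda>n. (\<Prod>i\<in>I. (\<integral>k. indicator (B i) k * mean_weight p s (real n) i ^ k \<partial>measure_pmf (poisson_pmf (\<sigma> i))) *
          exp (\<sigma> i * (1 - mean_weight p s (real n) i))) * ?c) \<longlonglongrightarrow>
        (\<Prod>i\<in>I. measure (measure_pmf (poisson_pmf (\<sigma> i))) (B i)) * ?c"
      by (intro tendsto_mult_right tendsto_prod site)
    ultimately show ?thesis by (simp add: mult.commute[of ?c])
  qed
  show ?thesis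
  proof (rule integral_weak_limit_extend[where G="?G"])
    show "sets ?\<mu> = sigma_sets (space ?\<mu>) ?G"
      unfolding sp sets_poisson_field sets_PiM by simp
    show "?G \<subseteq> Pow (space ?\<mu>)" by (simp add: sp)
    show "(\<lambda>n. \<integral>\<eta>. indicator A \<eta> * later_functional p s (real n) \<eta> \<partial>?\<mu>) \<longlonglongrightarrow> ?c * measure ?\<mu> A"
      if "A \<in> ?G" for A
      using that by (elim prod_algebraE) (rule cyl)
    show "(\<lambda>n. \<integral>\<eta>. later_functional p s (real n) \<eta> \<partial>?\<mu>) \<longlonglongrightarrow> ?c * measure ?\<mu> (space ?\<mu>)"
    proof -
      have "UNIV = prod_emb UNIV (\<lambda>_. count_space UNIV) {} (Pi\<^sub>E {} (\<lambda>_. UNIV :: nat set))"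
        by (auto simp: prod_emb_def space_PiM restrict_def)
      from cyl[OF _ this] show ?thesis by (simp add: sp)
    qed
    show "later_functional p s (real n) \<in> borel_measurable ?\<mu>" for n
      using measurable_later_functional[OF s(1)] by (simp cong: measurable_cong_sets add: sets_poisson_field)
  qed (use later_functional_bounds[OF s(1)] h in \<open>auto simp: mu.finite_measure Int_stable_prod_algebra\<close>)
qed

lemma stationary_absolutely_continuous_eq:
  assumes transient: "\<And>i j. (\<lambda>n. hop_prob (real n) i j) \<longlonglongrightarrow> 0"
    and st: "stationary p \<nu>" and ac: "absolutely_continuous (poisson_field \<sigma>) \<nu>"
  shows "\<nu> = poisson_field \<sigma>"
proof -
  let ?\<mu> = "poisson_field \<sigma>"
  interpret mu: prob_space ?\<mu> by (rule prob_space_poisson_field)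
  have prob: "prob_space \<nu>" and sets: "sets \<nu> = sets config_space" using st by (auto simp: stationary_def)
  interpret nu: prob_space \<nu> by (rule prob)
  have sets_eq: "sets \<nu> = sets ?\<mu>" by (simp add: sets sets_poisson_field)
  obtain D where D [measurable]: "D \<in> borel_measurable ?\<mu>" and RN: "AE x in ?\<mu>. RN_deriv ?\<mu> \<nu> x = ennreal (D x)"
    and D_nonneg: "\<And>x. 0 \<le> D x"
    using mu.real_RN_deriv[OF nu.finite_measure ac sets_eq] by blast
  have nu: "\<nu> = density ?\<mu> D"
  proof -
    have "\<nu> = density ?\<mu> (RN_deriv ?\<mu> \<nu>)" using mu.density_RN_deriv[OF ac sets_eq] by simp
    also have "\<dots> = density ?\<mu> D" by (rule density_cong[OF _ _ RN]) auto
    finally show ?thesis .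
  qed
  have int_D: "integrable ?\<mu> D" and D_1: "(\<integral>\<eta>. D \<eta> \<partial>?\<mu>) = 1"
  proof -
    have "(\<integral>\<^sup>+\<eta>. ennreal (D \<eta>) \<partial>?\<mu>) = emeasure (density ?\<mu> D) (space (density ?\<mu> D))"
      by (simp add: emeasure_density cong: nn_integral_cong)
    also have "\<dots> = 1" using nu.emeasure_space_1 unfolding nu .
    finally have nn: "(\<integral>\<^sup>+\<eta>. ennreal (D \<eta>) \<partial>?\<mu>) = 1" .
    then show "integrable ?\<mu> D" using D_nonneg by (intro integrableI_nonneg) auto
    show "(\<integral>\<eta>. D \<eta> \<partial>?\<mu>) = 1" using nn D_nonneg by (subst integral_eq_nn_integral) auto
  qed
  show ?thesis
  proof (rule config_measure_eqI[OF nu.finite_measure mu.finite_measure sets sets_poisson_field])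
    fix J :: "int set" and s :: "int \<Rightarrow> real"
    assume J: "finite J" and s: "\<And>j. 0 \<le> s j \<and> s j \<le> 1"
    define s' where "s' j = (if j \<in> J then s j else 1)" for j
    have s': "\<And>j. 0 \<le> s' j \<and> s' j \<le> 1" "\<And>j. j \<notin> J \<Longrightarrow> s' j = 1" using s by (auto simp: s'_def)
    have eq: "(\<Prod>j\<in>J. s j ^ \<eta> j) = (\<Prod>j\<in>J. s' j ^ \<eta> j)" for \<eta> :: "int \<Rightarrow> nat"
      by (intro prod.cong) (auto simp: s'_def)
    have "(\<integral>\<eta>. D \<eta> * later_functional p s' (real n) \<eta> \<partial>?\<mu>) = (\<integral>\<eta>. (\<Prod>j\<in>J. s' j ^ \<eta> j) \<partial>\<nu>)" for n
    proof -
      have meas: "later_functional p s' (real n) \<in> borel_measurable ?\<mu>"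
        using measurable_later_functional[OF s'(1)] by (simp cong: measurable_cong_sets add: sets_poisson_field)
      have "(\<integral>\<eta>. D \<eta> * later_functional p s' (real n) \<eta> \<partial>?\<mu>) = (\<integral>\<eta>. later_functional p s' (real n) \<eta> \<partial>\<nu>)"
        unfolding nu using meas D_nonneg by (subst integral_density) auto
      also have "\<dots> = (\<integral>\<eta>. (\<Prod>j\<in>J. s' j ^ \<eta> j) \<partial>\<nu>)"
        by (rule stationary_later_functional[OF st _ J s']) simp
      finally show ?thesis .
    qed
    moreover have "(\<lambda>n. \<integral>\<eta>. D \<eta> * later_functional p s' (real n) \<eta> \<partial>?\<mu>) \<longlonglongrightarrow>
        exp (- (\<Sum>j\<in>J. \<sigma> j * (1 - s' j))) * (\<integral>\<eta>. D \<eta> \<partial>?\<mu>)"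
      by (rule later_functional_mixing[OF transient J s' int_D])
    ultimately have "(\<lambda>n::nat. \<integral>\<eta>. (\<Prod>j\<in>J. s' j ^ \<eta> j) \<partial>\<nu>) \<longlonglongrightarrow> exp (- (\<Sum>j\<in>J. \<sigma> j * (1 - s' j)))"
      by (simp add: D_1)
    then have "(\<integral>\<eta>. (\<Prod>j\<in>J. s' j ^ \<eta> j) \<partial>\<nu>) = exp (- (\<Sum>j\<in>J. \<sigma> j * (1 - s' j)))"
      using LIMSEQ_unique tendsto_const by blast
    also have "\<dots> = (\<integral>\<eta>. (\<Prod>j\<in>J. s' j ^ \<eta> j) \<partial>?\<mu>)"
      by (rule integral_poisson_field_power[symmetric]) (use J s' intensity_pos in auto)
    finally show "(\<integral>\<eta>. (\<Prod>j\<in>J. s j ^ \<eta> j) \<partial>\<nu>) = (\<integral>\<eta>. (\<Prod>j\<in>J. s j ^ \<eta> j) \<partial>?\<mu>)"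
      by (simp only: eq)
  qed
qed

lemma extremal_poisson_field:
  assumes transient: "\<And>i j. (\<lambda>n. hop_prob (real n) i j) \<longlonglongrightarrow> 0"
  shows "extremal_stationary p (poisson_field \<sigma>)"
proof -
  let ?\<mu> = "poisson_field \<sigma>"
  interpret mu: prob_space ?\<mu> by (rule prob_space_poisson_field)
  have component: "\<nu> = ?\<mu>"
    if st: "stationary p \<nu>" and c: "0 < c"
      and le: "\<And>A. A \<in> sets config_space \<Longrightarrow> c * measure \<nu> A \<le> measure ?\<mu> A" for \<nu> and c :: real
  proof (rule stationary_absolutely_continuous_eq[OF transient st])
    have sets: "sets \<nu> = sets config_space" and prob: "prob_space \<nu>" using st by (auto simp: stationary_def)
    interpret nu: prob_space \<nu> by (rule prob)
    show "absolutely_continuous ?\<mu> \<nu>"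
      unfolding absolutely_continuous_def
    proof
      fix A assume "A \<in> null_sets ?\<mu>"
      then have A: "A \<in> sets config_space" "measure ?\<mu> A = 0"
        by (auto simp: null_sets_def sets_poisson_field measure_def)
      then have "c * measure \<nu> A \<le> 0" using le[of A] by simp
      with c have "measure \<nu> A = 0"
        using measure_nonneg[of \<nu> A] by (simp add: mult_le_0_iff)
      then show "A \<in> null_sets \<nu>" using A sets by (simp add: null_sets_def nu.emeasure_eq_measure)
    qed
  qed
  show ?thesis
    unfolding extremal_stationary_def
  proof (intro conjI allI impI)
    show "stationary p ?\<mu>" by (rule stationary_poisson_field)
    fix \<mu>1 \<mu>2 and c :: real
    assume st: "stationary p \<mu>1" "stationary p \<mu>2" and c: "0 < c" "c < 1"
      and mix: "\<forall>A\<in>sets config_space. measure ?\<mu> A = c * measure \<mu>1 A + (1 - c) * measure \<mu>2 A"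
    show "\<mu>1 = ?\<mu>" by (rule component[OF st(1) c(1)]) (use mix c in simp)
    show "\<mu>2 = ?\<mu>" by (rule component[OF st(2), of "1 - c"]) (use mix c in simp_all)
  qed
qed

lemma poisson_field_has_flux:
  assumes flux: "\<And>i. p i * \<sigma> i - (1 - p (i + 1)) * \<sigma> (i + 1) = \<phi>"
  shows "has_flux p (poisson_field \<sigma>) \<phi>"
proof -
  note nn = nn_integral_poisson_field_site[of \<sigma>, OF intensity_pos]
  have [measurable]: "(\<lambda>\<eta>. real (\<eta> i)) \<in> borel_measurable (poisson_field \<sigma>)" for i by measurable
  have "integrable (poisson_field \<sigma>) (\<lambda>\<eta>. real (\<eta> i))" for i
    by (rule integrableI_nonneg) (simp_all add: nn)
  moreover have "site_mean (poisson_field \<sigma>) i = \<sigma> i" for i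
    unfolding site_mean_def by (subst integral_eq_nn_integral) (simp_all add: nn intensity_pos less_imp_le)
  ultimately show ?thesis using flux by (simp add: has_flux_def)
qed

end

section \<open>Environments with a nonzero flux\<close>

lemma (in stationary_intensity) extremal_stationary_with_flux:
  assumes "\<And>i j. (\<lambda>n. step_prob p n i j) \<longlonglongrightarrow> 0"
    and "\<And>i. p i * \<sigma> i - (1 - p (i + 1)) * \<sigma> (i + 1) = \<phi>"
  shows "extremal_stationary p (poisson_field \<sigma>) \<and> has_flux p (poisson_field \<sigma>) \<phi>"
  using assms by (intro conjI extremal_poisson_field hop_prob_tendsto_0 poisson_field_has_flux)

text \<open>The solution \<open>\<sigma>\<close> of \<open>p i * \<sigma> i - (1 - p (i + 1)) * \<sigma> (i + 1) = 1\<close> obtained by iterating to the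
  right.\<close>
definition flux_intensity :: "(int \<Rightarrow> real) \<Rightarrow> int \<Rightarrow> real" where
  "flux_intensity p i = (\<Sum>n. odds_prod p i n) / p i"

context environment
begin

context
  assumes summable_odds: "\<And>i. summable (odds_prod p i)"
begin

lemma flux_intensity_pos: "0 < flux_intensity p i"
  unfolding flux_intensity_def using p_pos[of i] odds_prod_pos
  by (intro divide_pos_pos suminf_pos summable_odds) auto

lemma flux_intensity_flux: "p i * flux_intensity p i - (1 - p (i + 1)) * flux_intensity p (i + 1) = 1"
proof -
  have shift: "odds_prod p i (Suc n) = (1 - p (i + 1)) / p (i + 1) * odds_prod p (i + 1) n" for n
    unfolding odds_prod_def by (subst prod.lessThan_Suc_shift) (simp add: add_ac)
  have "(\<Sum>n. odds_prod p i n) = (\<Sum>n. odds_prod p i (Suc n)) + odds_prod p i 0"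
    using suminf_split_head[OF summable_odds[of i]] by simp
  also have "\<dots> = (1 - p (i + 1)) / p (i + 1) * (\<Sum>n. odds_prod p (i + 1) n) + 1"
    unfolding shift suminf_mult[OF summable_odds] by (simp add: odds_prod_def[of p i 0])
  finally show ?thesis
    using p_pos[of i] by (simp add: flux_intensity_def)
qed

lemma flux_intensity_balance:
  "flux_intensity p i = flux_intensity p (i - 1) * p (i - 1) + flux_intensity p (i + 1) * (1 - p (i + 1))"
  using flux_intensity_flux[of i] flux_intensity_flux[of "i - 1"] by (simp add: algebra_simps)

lemma exists_positive_flux: "\<exists>\<mu> \<phi>. extremal_stationary p \<mu> \<and> has_flux p \<mu> \<phi> \<and> \<phi> > 0"
proof -
  interpret stationary_intensity p "flux_intensity p"
    by unfold_locales (fact flux_intensity_pos flux_intensity_balance)+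
  show ?thesis
    using extremal_stationary_with_flux[OF step_prob_tendsto_0[OF summable_odds] flux_intensity_flux]
    by (intro exI[of _ "poisson_field (flux_intensity p)"] exI[of _ 1]) simp
qed

end

text \<open>Reflecting the intensities reverses the sign of the flux.\<close>
lemma exists_negative_flux:
  assumes summable: "\<And>i. summable (odds_prod (\<lambda>i. 1 - p (- i)) i)"
  shows "\<exists>\<mu> \<phi>. extremal_stationary p \<mu> \<and> has_flux p \<mu> \<phi> \<and> \<phi> < 0"
proof -
  let ?p' = "\<lambda>i. 1 - p (- i)"
  interpret mirror: environment ?p' by unfold_locales (simp_all add: p_pos p_less_1)
  define \<sigma> where "\<sigma> i = flux_intensity ?p' (- i)" for i
  have flux: "p i * \<sigma> i - (1 - p (i + 1)) * \<sigma> (i + 1) = - 1" for i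
    using mirror.flux_intensity_flux[OF summable, of "- (i + 1)"] by (simp add: \<sigma>_def add.commute[of 1 i])
  have bal: "\<sigma> i = \<sigma> (i - 1) * p (i - 1) + \<sigma> (i + 1) * (1 - p (i + 1))" for i
    using flux[of i] flux[of "i - 1"] by (simp add: algebra_simps)
  interpret stationary_intensity p \<sigma>
    by unfold_locales (simp add: \<sigma>_def mirror.flux_intensity_pos[OF summable], rule bal)
  have "(\<lambda>n. step_prob p n i j) \<longlonglongrightarrow> 0" for i j
    using mirror.step_prob_tendsto_0[OF summable, of "- i" "- j"] by (simp only: step_prob_mirror)
  from extremal_stationary_with_flux[OF this flux] show ?thesis
    by (intro exI[of _ "poisson_field \<sigma>"] exI[of _ "- 1"]) simp
qed

end

section \<open>Random environments\<close>

lemma (in prob_space) indep_vars_subfamily: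
  assumes indep: "indep_vars (\<lambda>_. borel) X UNIV" and inj: "inj f"
  shows "indep_vars (\<lambda>_. borel) (\<lambda>k. X (f k)) UNIV"
proof -
  let ?F = "\<lambda>i. {X i -` A \<inter> space M |A. A \<in> sets borel}"
  have rv: "random_variable borel (X i)" for i using indep by (auto simp: indep_vars_def2)
  have ind: "indep_sets ?F UNIV" using indep by (auto simp: indep_vars_def2)
  have "indep_sets (\<lambda>k. ?F (f k)) UNIV"
  proof (rule indep_setsI)
    show "?F (f k) \<subseteq> events" for k using rv by (auto intro: measurable_sets)
    fix A J assume J: "J \<noteq> {}" "J \<subseteq> UNIV" "finite J" and A: "\<forall>j\<in>J. A j \<in> ?F (f j)"
    have inv: "inv f (f j) = j" for j using inj by simp
    have "prob (\<Inter>i\<in>f ` J. A (inv f i)) = (\<Prod>i\<in>f ` J. prob (A (inv f i)))"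
      by (rule indep_setsD[OF ind]) (use J A in \<open>auto simp: inv\<close>)
    then show "prob (\<Inter>j\<in>J. A j) = (\<Prod>j\<in>J. prob (A j))"
      using inj by (simp add: prod.reindex inj_on_subset inv)
  qed
  then show ?thesis using rv by (simp add: indep_vars_def2)
qed

lemma AE_summable_odds_prod:
  fixes p :: "int \<Rightarrow> 'a \<Rightarrow> real"
  assumes M: "prob_space M" and indep: "prob_space.indep_vars M (\<lambda>_. borel) p UNIV"
    and ident: "\<And>i. distr M borel (p i) = distr M borel (p 0)"
    and unit: "\<And>i \<omega>. \<omega> \<in> space M \<Longrightarrow> 0 < p i \<omega> \<and> p i \<omega> < 1"
    and ex: "expectation_exists M (\<lambda>\<omega>. ln (p 0 \<omega> / (1 - p 0 \<omega>)))"
    and pos: "ext_expectation M (\<lambda>\<omega>. ln (p 0 \<omega> / (1 - p 0 \<omega>))) > 0"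
  shows "AE \<omega> in M. \<forall>i. summable (odds_prod (\<lambda>i. p i \<omega>) i)"
proof -
  interpret prob_space M by fact
  have rv [measurable]: "p i \<in> borel_measurable M" for i
    using indep by (auto simp: indep_vars_def)
  have transfer: "(\<integral>\<^sup>+\<omega>. g (p i \<omega>) \<partial>M) = (\<integral>\<^sup>+\<omega>. g (p 0 \<omega>) \<partial>M)"
    if [measurable]: "g \<in> borel_measurable borel" for g :: "real \<Rightarrow> ennreal" and i
    using nn_integral_distr[of "p i" M borel g] nn_integral_distr[of "p 0" M borel g] ident[of i] by simp
  have "AE \<omega> in M. summable (odds_prod (\<lambda>i. p i \<omega>) i)" for i
  proof -
    have eq: "(\<integral>\<^sup>+\<omega>. ennreal (ln (p i \<omega> / (1 - p i \<omega>))) \<partial>M) = (\<integral>\<^sup>+\<omega>. ennreal (ln (p 0 \<omega> / (1 - p 0 \<omega>))) \<partial>M)"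
      "(\<integral>\<^sup>+\<omega>. ennreal (- ln (p i \<omega> / (1 - p i \<omega>))) \<partial>M) = (\<integral>\<^sup>+\<omega>. ennreal (- ln (p 0 \<omega> / (1 - p 0 \<omega>))) \<partial>M)" for i
      by (rule transfer[of "\<lambda>x. ennreal (ln (x / (1 - x)))"] transfer[of "\<lambda>x. ennreal (- ln (x / (1 - x)))"]; measurable)+
    have "AE \<omega> in M. summable (\<lambda>n. \<Prod>k<n. (1 - p (i + 1 + int k) \<omega>) / p (i + 1 + int k) \<omega>)"
    proof (rule AE_summable_prod_odds[OF M])
      show "indep_vars (\<lambda>_. borel) (\<lambda>k. p (i + 1 + int k)) UNIV"
        by (rule indep_vars_subfamily[OF indep]) (simp add: inj_def)
      show "distr M borel (p (i + 1 + int k)) = distr M borel (p (i + 1 + int 0))" for k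
        using ident[of "i + 1 + int k"] ident[of "i + 1 + int 0"] by simp
      show "expectation_exists M (\<lambda>\<omega>. ln (p (i + 1 + int 0) \<omega> / (1 - p (i + 1 + int 0) \<omega>)))"
        using ex unfolding expectation_exists_def eq[of "i + 1 + int 0"] by simp
      show "ext_expectation M (\<lambda>\<omega>. ln (p (i + 1 + int 0) \<omega> / (1 - p (i + 1 + int 0) \<omega>))) > 0"
        using pos unfolding ext_expectation_def eq[of "i + 1 + int 0"] .
    qed (use unit in auto)
    then show ?thesis by (simp add: odds_prod_def[abs_def])
  qed
  then show ?thesis by (simp add: AE_all_countable)
qed

theorem theorem4:
  fixes M :: "'a measure" and p :: "int \<Rightarrow> 'a \<Rightarrow> real"
  assumes "prob_space M"
    and "prob_space.indep_vars M (\<lambda>_. borel) p UNIV"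
    and "\<And>i. distr M borel (p i) = distr M borel (p 0)"
    and "\<And>i \<omega>. \<omega> \<in> space M \<Longrightarrow> 0 < p i \<omega> \<and> p i \<omega> < 1"
  shows "(expectation_exists M (\<lambda>\<omega>. ln (p 0 \<omega> / (1 - p 0 \<omega>))) \<and>
          ext_expectation M (\<lambda>\<omega>. ln (p 0 \<omega> / (1 - p 0 \<omega>))) > 0 \<longrightarrow>
          (AE \<omega> in M. \<exists>\<mu> \<phi>. extremal_stationary (\<lambda>i. p i \<omega>) \<mu> \<and>
                             has_flux (\<lambda>i. p i \<omega>) \<mu> \<phi> \<and> \<phi> > 0)) \<and>
         (expectation_exists M (\<lambda>\<omega>. ln ((1 - p 0 \<omega>) / p 0 \<omega>)) \<and>
          ext_expectation M (\<lambda>\<omega>. ln ((1 - p 0 \<omega>) / p 0 \<omega>)) > 0 \<longrightarrow>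
          (AE \<omega> in M. \<exists>\<mu> \<phi>. extremal_stationary (\<lambda>i. p i \<omega>) \<mu> \<and>
                             has_flux (\<lambda>i. p i \<omega>) \<mu> \<phi> \<and> \<phi> < 0))"
proof (intro conjI impI; elim conjE)
  interpret prob_space M by fact
  have env: "environment (\<lambda>i. p i \<omega>)" if "\<omega> \<in> space M" for \<omega>
    using assms(4)[OF that] by unfold_locales auto
  {
    assume ex: "expectation_exists M (\<lambda>\<omega>. ln (p 0 \<omega> / (1 - p 0 \<omega>)))"
      and pos: "ext_expectation M (\<lambda>\<omega>. ln (p 0 \<omega> / (1 - p 0 \<omega>))) > 0"
    have "AE \<omega> in M. \<forall>i. summable (odds_prod (\<lambda>i. p i \<omega>) i)"
      by (rule AE_summable_odds_prod[OF assms ex pos])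
    then show "AE \<omega> in M. \<exists>\<mu> \<phi>. extremal_stationary (\<lambda>i. p i \<omega>) \<mu> \<and> has_flux (\<lambda>i. p i \<omega>) \<mu> \<phi> \<and> \<phi> > 0"
    proof (rule AE_mp, intro AE_I2 impI)
      fix \<omega> assume "\<omega> \<in> space M" "\<forall>i. summable (odds_prod (\<lambda>i. p i \<omega>) i)"
      then show "\<exists>\<mu> \<phi>. extremal_stationary (\<lambda>i. p i \<omega>) \<mu> \<and> has_flux (\<lambda>i. p i \<omega>) \<mu> \<phi> \<and> \<phi> > 0"
        by (intro environment.exists_positive_flux[OF env]) auto
    qed
  next
    assume ex: "expectation_exists M (\<lambda>\<omega>. ln ((1 - p 0 \<omega>) / p 0 \<omega>))"
      and pos: "ext_expectation M (\<lambda>\<omega>. ln ((1 - p 0 \<omega>) / p 0 \<omega>)) > 0"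
    define p' where "p' i \<omega> = 1 - p (- i) \<omega>" for i \<omega>
    have rv [measurable]: "p i \<in> borel_measurable M" for i
      using assms(2) by (auto simp: indep_vars_def)
    have "AE \<omega> in M. \<forall>i. summable (odds_prod (\<lambda>i. p' i \<omega>) i)"
    proof (rule AE_summable_odds_prod[OF assms(1)])
      have "indep_vars (\<lambda>_. borel) (\<lambda>i. p (- i)) UNIV"
        by (rule indep_vars_subfamily[OF assms(2)]) (simp add: inj_def)
      then show "indep_vars (\<lambda>_. borel) p' UNIV"
        unfolding p'_def[abs_def] by (rule indep_vars_compose2) measurable
      have "distr M borel (p' i) = distr (distr M borel (p (- i))) borel (\<lambda>x. 1 - x)" for i
        by (subst distr_distr) (auto simp: comp_def p'_def[abs_def])
      then have "distr M borel (p' i) = distr (distr M borel (p 0)) borel (\<lambda>x. 1 - x)" for i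
        by (simp only: assms(3)[of "- i"])
      then show "distr M borel (p' i) = distr M borel (p' 0)" for i by metis
      show "expectation_exists M (\<lambda>\<omega>. ln (p' 0 \<omega> / (1 - p' 0 \<omega>)))" using ex by (simp add: p'_def)
      show "ext_expectation M (\<lambda>\<omega>. ln (p' 0 \<omega> / (1 - p' 0 \<omega>))) > 0" using pos by (simp add: p'_def)
    qed (use assms(4) in \<open>auto simp: p'_def\<close>)
    then show "AE \<omega> in M. \<exists>\<mu> \<phi>. extremal_stationary (\<lambda>i. p i \<omega>) \<mu> \<and> has_flux (\<lambda>i. p i \<omega>) \<mu> \<phi> \<and> \<phi> < 0"
    proof (rule AE_mp, intro AE_I2 impI)
      fix \<omega> assume "\<omega> \<in> space M" "\<forall>i. summable (odds_prod (\<lambda>i. p' i \<omega>) i)"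
      then show "\<exists>\<mu> \<phi>. extremal_stationary (\<lambda>i. p i \<omega>) \<mu> \<and> has_flux (\<lambda>i. p i \<omega>) \<mu> \<phi> \<and> \<phi> < 0"
        by (intro environment.exists_negative_flux[OF env]) (auto simp: p'_def)
    qed
  }
qed

end
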